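(* Let $k$ be a field with $\operatorname{char}(k)\neq 2,3$, and let $\Pi=\{\{A_1,A_2,A_3\},\{B_1,B_2,B_3\}\}$ be a Pappus structure in the projective plane $\mathbb{P}^2$ over $k$ with signature $\mathrm{sig}(\Pi)=[x,y]$. Assume $x\neq y$. Then $$\mathrm{sig}(\mathrm{steiner}(\Pi))=\left[\frac{2y\,(y-x+2)}{(x-y)^2},\ \frac{y^2}{(x-y)^2}\right].$$
   Context: Cross-ratio: for four points of $\mathbb{P}^1$, $\langle x_1,x_2,x_3,x_4\rangle=\frac{(x_1-x_3)(x_2-x_4)}{(x_2-x_3)(x_1-x_4)}$; for four collinear points of a projective plane, use any projective isomorphism of their line with $\mathbb{P}^1$. Put $j(r)=\frac{4(r^2-r+1)^3}{27r^2(r-1)^2}$ for $r\ne 0,1$. Pappus structure: an unordered pair of sets of points $\{\{A_1,A_2,A_3\},\{B_1,B_2,B_3\}\}$ in a projective plane over $k$ such that the six points are pairwise distinct, the three points in each set are collinear, the line containing the first three differs from the line containing the other three, and the intersection point $P$ of the two lines is different from all six points. Signature: with $r=\langle A_1,A_2,A_3,P\rangle$ and $s=\langle B_1,B_2,B_3,P\rangle$, $\mathrm{sig}(\Pi)=[\,j(r)+j(s),\ j(r)j(s)\,]\in k^2$; this does not depend on the orderings. Pappus lines: for $\sigma\in\mathfrak{S}_3$, let $\Lambda_\sigma$ be the line containing the three points $A_iB_{\sigma(j)}\cap A_jB_{\sigma(i)}$ for $(i,j)=(1,2),(2,3),(1,3)$ (these are collinear by Pappus's theorem). By Steiner's theorem,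 the three lines with $\sigma$ even are concurrent, and so are the three lines with $\sigma$ odd. Define $$\mathrm{steiner}(\Pi)=\{\{\Lambda_e,\Lambda_{(1\,2\,3)},\Lambda_{(1\,3\,2)}\},\{\Lambda_{(1\,2)},\Lambda_{(1\,3)},\Lambda_{(2\,3)}\}\},$$ whose elements are regarded as points of the dual projective plane $(\mathbb{P}^2)^\vee$. When $x\neq y$ this is a Pappus structure in $(\mathbb{P}^2)^\vee$, so that its signature is defined. *)

theory Defs
  imports "HOL-Analysis.Cartesian_Space" "HOL-Combinatorics.Cycles"
begin

definition proportional :: "'a::field^'n \<Rightarrow> 'a^'n \<Rightarrow> bool"
  where "proportional v w \<longleftrightarrow> v \<noteq> 0 \<and> (\<exists>c. c \<noteq> 0 \<and> w = c *s v)"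

lemma part_equivp_proportional: "part_equivp (proportional :: 'a::field^'n \<Rightarrow> 'a^'n \<Rightarrow> bool)"
proof (rule part_equivpI)
  have "((\<chi> i. 1) :: 'a^'n) \<noteq> 0"
    by (simp add: vec_eq_iff)
  then show "\<exists>v :: 'a^'n. proportional v v"
    unfolding proportional_def by (metis vector_smult_lid zero_neq_one)
  show "symp (proportional :: 'a^'n \<Rightarrow> 'a^'n \<Rightarrow> bool)"
  proof (rule sympI)
    fix v w :: "'a^'n"
    assume "proportional v w"
    then obtain c where c: "v \<noteq> 0" "c \<noteq> 0" "w = c *s v"
      unfolding proportional_def by blast
    then have "v = inverse c *s w" "w \<noteq> 0" "inverse c \<noteq> 0"
      by (simp_all add: vector_smult_assoc)
    then show "proportional w v"
      unfolding proportional_def by blast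
  qed
  show "transp (proportional :: 'a^'n \<Rightarrow> 'a^'n \<Rightarrow> bool)"
    unfolding proportional_def transp_def
    by (metis vector_smult_assoc mult_eq_0_iff)
qed

text \<open>The projective space of dimension \<open>CARD('n) - 1\<close> over \<open>'a\<close>; \<open>proj_pt v\<close> is the
  point with homogeneous coordinates \<open>v\<close> (meaningful only for \<open>v \<noteq> 0\<close>).\<close>

quotient_type (overloaded) ('a, 'n) proj = "'a::field^'n::finite" / partial: proportional
  morphisms proj_rep proj_pt
  by (rule part_equivp_proportional)

type_synonym 'a proj_line = "('a, 2) proj"
type_synonym 'a proj_plane = "('a, 3) proj"

text \<open>The line \<open>l\<^sub>1 X\<^sub>1 + l\<^sub>2 X\<^sub>2 + l\<^sub>3 X\<^sub>3 = 0\<close> of the plane is given by its dual coordinates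
  \<open>[l\<^sub>1 : l\<^sub>2 : l\<^sub>3]\<close>, i.e. as a point of the dual projective plane. In these coordinates the
  dual plane is again \<open>'a proj_plane\<close>, so that every notion below applies to it as well.\<close>

type_synonym 'a dual_plane = "('a, 3) proj"

lift_definition incident :: "'a::field proj_plane \<Rightarrow> 'a dual_plane \<Rightarrow> bool"
  is "\<lambda>p l. (\<Sum>i\<in>UNIV. p $ i * l $ i) = 0"
proof -
  fix p p' l l' :: "'a^3"
  assume "proportional p p'" "proportional l l'"
  then obtain c d where "c \<noteq> 0" "d \<noteq> 0" "p' = c *s p" "l' = d *s l"
    unfolding proportional_def by blast
  moreover from this have "(\<Sum>i\<in>UNIV. p' $ i * l' $ i) = (c * d) * (\<Sum>i\<in>UNIV. p $ i * l $ i)"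
    by (simp add: sum_distrib_left mult_ac)
  ultimately show "((\<Sum>i\<in>UNIV. p $ i * l $ i) = 0) = ((\<Sum>i\<in>UNIV. p' $ i * l' $ i) = 0)"
    by simp
qed

definition proj_collinear :: "'a::field proj_plane set \<Rightarrow> bool"
  where "proj_collinear S \<longleftrightarrow> (\<exists>L. \<forall>P\<in>S. incident P L)"

definition line_containing :: "'a::field proj_plane set \<Rightarrow> 'a dual_plane"
  where "line_containing S = (THE L. \<forall>P\<in>S. incident P L)"

definition meet :: "'a::field dual_plane \<Rightarrow> 'a dual_plane \<Rightarrow> 'a proj_plane"
  where "meet L M = (THE P. incident P L \<and> incident P M)"

text \<open>The expression \<open>(x\<^sub>1 - x\<^sub>3) (x\<^sub>2 - x\<^sub>4) / ((x\<^sub>2 - x\<^sub>3) (x\<^sub>1 - x\<^sub>4))\<close> in homogeneous coordinates,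
  which includes the point at infinity: \<open>det2 u v\<close> is \<open>x - y\<close> for \<open>u = (x, 1)\<close> and \<open>v = (y, 1)\<close>.\<close>

definition det2 :: "'a::field^2 \<Rightarrow> 'a^2 \<Rightarrow> 'a"
  where "det2 u v = u $ 1 * v $ 2 - u $ 2 * v $ 1"

lemma det2_scale: "det2 (c *s u) (d *s v) = c * d * det2 u v"
  by (simp add: det2_def algebra_simps)

lift_definition cross_ratio1 ::
    "'a::field proj_line \<Rightarrow> 'a proj_line \<Rightarrow> 'a proj_line \<Rightarrow> 'a proj_line \<Rightarrow> 'a"
  is "\<lambda>x1 x2 x3 x4. (det2 x1 x3 * det2 x2 x4) / (det2 x2 x3 * det2 x1 x4)"
  by (auto simp: proportional_def det2_scale)

text \<open>\<open>\<phi>\<close> is a projective isomorphism of the projective line with a line of the plane.\<close>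

definition proj_line_iso :: "('a::field proj_line \<Rightarrow> 'a proj_plane) \<Rightarrow> bool"
  where "proj_line_iso \<phi> \<longleftrightarrow>
    (\<exists>M :: 'a^2^3. inj ((*v) M) \<and> (\<forall>u. u \<noteq> 0 \<longrightarrow> \<phi> (proj_pt u) = proj_pt (M *v u)))"

definition cross_ratio ::
    "'a::field proj_plane \<Rightarrow> 'a proj_plane \<Rightarrow> 'a proj_plane \<Rightarrow> 'a proj_plane \<Rightarrow> 'a"
  where "cross_ratio P1 P2 P3 P4 =
    (THE r. \<exists>\<phi> x1 x2 x3 x4. proj_line_iso \<phi> \<and>
       \<phi> x1 = P1 \<and> \<phi> x2 = P2 \<and> \<phi> x3 = P3 \<and> \<phi> x4 = P4 \<and> r = cross_ratio1 x1 x2 x3 x4)"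

definition j_inv :: "'a::field \<Rightarrow> 'a"
  where "j_inv r = 4 * (r^2 - r + 1)^3 / (27 * r^2 * (r - 1)^2)"

text \<open>Ordered triples are functions on the three-element type \<open>3\<close>, whose elements are
  \<open>1\<close>, \<open>2\<close> and \<open>3\<close> (\<open>= 0\<close>).\<close>

definition vertex :: "(3 \<Rightarrow> 'a::field proj_plane) \<Rightarrow> (3 \<Rightarrow> 'a proj_plane) \<Rightarrow> 'a proj_plane"
  where "vertex A B = meet (line_containing (range A)) (line_containing (range B))"

definition pappus_labelling ::
    "'a::field proj_plane set set \<Rightarrow> (3 \<Rightarrow> 'a proj_plane) \<Rightarrow> (3 \<Rightarrow> 'a proj_plane) \<Rightarrow> bool"
  where "pappus_labelling \<P> A B \<longleftrightarrow>
    \<P> = {range A, range B} \<and>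
    inj A \<and> inj B \<and> range A \<inter> range B = {} \<and>
    proj_collinear (range A) \<and> proj_collinear (range B) \<and>
    line_containing (range A) \<noteq> line_containing (range B) \<and>
    vertex A B \<notin> range A \<union> range B"

definition pappus_structure :: "'a::field proj_plane set set \<Rightarrow> bool"
  where "pappus_structure \<P> \<longleftrightarrow> (\<exists>A B. pappus_labelling \<P> A B)"

text \<open>The definite descriptions in \<open>signature\<close> and \<open>steiner\<close> express that the result is the
  same for all labellings of the structure.\<close>

definition signature :: "'a::field proj_plane set set \<Rightarrow> 'a \<times> 'a"
  where "signature \<P> =
    (THE z. \<exists>A B r s. pappus_labelling \<P> A B \<and>
       r = cross_ratio (A 1) (A 2) (A 3) (vertex A B) \<and>
       s = cross_ratio (B 1) (B 2) (B 3) (vertex A B) \<and>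
       z = (j_inv r + j_inv s, j_inv r * j_inv s))"

definition pappus_line ::
    "(3 \<Rightarrow> 'a::field proj_plane) \<Rightarrow> (3 \<Rightarrow> 'a proj_plane) \<Rightarrow> (3 \<Rightarrow> 3) \<Rightarrow> 'a dual_plane"
  where "pappus_line A B \<sigma> =
    line_containing
      ((\<lambda>(i, j). meet (line_containing {A i, B (\<sigma> j)}) (line_containing {A j, B (\<sigma> i)}))
         ` {(1, 2), (2, 3), (1, 3)})"

definition steiner :: "'a::field proj_plane set set \<Rightarrow> 'a dual_plane set set"
  where "steiner \<P> =
    (THE S. \<exists>A B. pappus_labelling \<P> A B \<and>
       S = {{pappus_line A B id,
             pappus_line A B (cycle_of_list [1, 2, 3]),
             pappus_line A B (cycle_of_list [1, 3, 2])},
            {pappus_line A B (cycle_of_list [1, 2]),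
             pappus_line A B (cycle_of_list [1, 3]),
             pappus_line A B (cycle_of_list [2, 3])}})"

end

(* In a basis u, v, w with P = [w], A_i = [u + a_i w], B_i = [v + b_i w], both invariants j become
   symmetric functions of the triples a, b. Let L_c and M_c be the vectors of the even and odd
   Pappus lines (c in Z/3), and let m_c, n_c be their pairings with the Steiner point of the other
   family. As the L_c add up to zero, so do the m_c, and the cross-ratio of L_1, L_2, L_3 and the
   vertex of the dual structure is a ratio of two of the m_c; the same holds for M_c and n_c.
   Up to a common factor, m_c is the centred inner product of a with the shift of b by c, so that
   m_1^2 + m_1 m_2 + m_2^2 is three times the product of the quadratic invariants of a and b, and
   the products M, N of the m_c and of the n_c satisfy M - N = 27 V(a) V(b) with V the Vandermonde
   product. This gives x - y = -4 M N / (M - N)^2, so that the dual structure is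
   non-degenerate when x and y differ, and the claimed formula. *)

theory Submission
  imports Defs
begin

section \<open>Vectors representing points and lines\<close>

lemma proportional_refl_iff [simp]: "proportional v v \<longleftrightarrow> v \<noteq> 0"
  unfolding proportional_def by (metis vector_smult_lid zero_neq_one)

lemma proj_pt_eq_iff:
  assumes "v \<noteq> 0" "w \<noteq> 0"
  shows "proj_pt v = proj_pt w \<longleftrightarrow> (\<exists>c. c \<noteq> 0 \<and> w = c *s v)"
  using Quotient3_rel[OF Quotient3_proj, of v w] assms
  by (auto simp: proportional_def)

lemma proj_pt_smult [simp]:
  assumes "c \<noteq> 0" "v \<noteq> 0"
  shows "proj_pt (c *s v) = proj_pt v"
  using assms by (metis proj_pt_eq_iff vector_mul_eq_0)

lemma proj_ptE:
  obtains v where "v \<noteq> 0" "P = proj_pt v"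
proof
  show "proj_rep P \<noteq> 0"
    using Quotient3_rep_reflp[OF Quotient3_proj, of P] by simp
  show "P = proj_pt (proj_rep P)"
    using Quotient3_abs_rep[OF Quotient3_proj, of P] by simp
qed

lemma proj_rep_proj_pt:
  assumes "v \<noteq> 0"
  obtains c where "c \<noteq> 0" "proj_rep (proj_pt v) = c *s v"
proof -
  have "proportional v (proj_rep (proj_pt v))"
    using Quotient3_rel_rep[OF Quotient3_proj] Quotient3_rep_abs[OF Quotient3_proj] assms
    by (metis part_equivp_proportional part_equivp_symp proportional_refl_iff)
  then show ?thesis using that unfolding proportional_def by blast
qed

section \<open>Dot, cross and triple products in k^3\<close>

definition dot :: "'a::field^3 \<Rightarrow> 'a^3 \<Rightarrow> 'a"
  where "dot p l = (\<Sum>i\<in>UNIV. p $ i * l $ i)"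

definition cross :: "'a::field^3 \<Rightarrow> 'a^3 \<Rightarrow> 'a^3"
  where "cross p q = vector [p $ 2 * q $ 3 - p $ 3 * q $ 2,
     p $ 3 * q $ 1 - p $ 1 * q $ 3, p $ 1 * q $ 2 - p $ 2 * q $ 1]"

definition det3 :: "'a::field^3 \<Rightarrow> 'a^3 \<Rightarrow> 'a^3 \<Rightarrow> 'a"
  where "det3 u v w = dot u (cross v w)"

lemma dot_3: "dot p l = p $ 1 * l $ 1 + p $ 2 * l $ 2 + p $ 3 * l $ 3"
  by (simp add: dot_def sum_3)

lemma dot_commute: "dot p q = dot q p"
  by (simp add: dot_def mult.commute)

lemma cross_nth [simp]:
  "cross p q $ 1 = p $ 2 * q $ 3 - p $ 3 * q $ 2"
  "cross p q $ 2 = p $ 3 * q $ 1 - p $ 1 * q $ 3"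
  "cross p q $ 3 = p $ 1 * q $ 2 - p $ 2 * q $ 1"
  by (simp_all add: cross_def)

lemmas vec3_simps = dot_3 det3_def vec_eq_iff forall_3

lemma cross_0 [simp]: "cross 0 q = 0" "cross p 0 = 0"
  by (simp_all add: vec3_simps)

lemma dot_0 [simp]: "dot 0 q = 0" "dot p 0 = 0"
  by (simp_all add: vec3_simps)

lemma dot_linear [simp]:
  "dot (p + q) l = dot p l + dot q l" "dot (p - q) l = dot p l - dot q l"
  "dot (- p) l = - dot p l" "dot (c *s p) l = c * dot p l"
  "dot l (p + q) = dot l p + dot l q" "dot l (p - q) = dot l p - dot l q"
  "dot l (- p) = - dot l p" "dot l (c *s p) = c * dot l p"
  by (simp_all add: vec3_simps algebra_simps)

lemma dot_cross_self [simp]: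
  "dot p (cross p q) = 0" "dot q (cross p q) = 0"
  "dot (cross p q) p = 0" "dot (cross p q) q = 0"
  by (simp_all add: vec3_simps algebra_simps)

lemma cross_commute: "cross q p = - cross p q"
  by (simp add: vec3_simps)

lemma cross_cross: "cross l (cross p q) = dot l q *s p - dot l p *s q"
  by (simp add: vec3_simps algebra_simps)

lemma cross_smult: "cross (c *s p) (d *s q) = (c * d) *s cross p q"
  by (simp add: vec3_simps algebra_simps)

text \<open>The products n_k l_i and l_k n_i agree for all i and k, so dividing by one nonzero
  coordinate of n gives the factor.\<close>

lemma cross_eq_0D:
  assumes "cross n l = 0" "n \<noteq> 0"
  obtains c where "l = c *s n"
proof -
  obtain k where k: "n $ k \<noteq> 0"
    using \<open>n \<noteq> 0\<close> by (auto simp: vec_eq_iff)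
  have "n $ k * l $ i = l $ k * n $ i" for i
    using assms(1) exhaust_3[of k] exhaust_3[of i]
    by (auto simp: vec3_simps algebra_simps)
  then have "l = (l $ k / n $ k) *s n"
    using k by (simp add: vec_eq_iff field_simps)
  then show ?thesis using that by blast
qed

lemma cross_neq_0I:
  assumes "proj_pt p \<noteq> proj_pt q" "p \<noteq> 0" "q \<noteq> 0"
  shows "cross p q \<noteq> 0"
proof
  assume "cross p q = 0"
  then obtain c where "q = c *s p" using cross_eq_0D assms by blast
  then show False using assms by (metis proj_pt_eq_iff vector_mul_eq_0)
qed

text \<open>By the triple product expansion, l is parallel to the normal of the plane spanned by p
  and q. Projectively, this is uniqueness of the line through two points and, dually, of the meeting
  point of two lines.\<close>

lemma orthogonal_both:
  assumes "dot p l = 0" "dot q l = 0" "cross p q \<noteq> 0"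
  obtains c where "l = c *s cross p q"
proof -
  have "cross (cross p q) l = 0"
    using cross_cross[of l p q] cross_commute[of l "cross p q"] assms
    by (simp add: dot_commute[of l])
  then show ?thesis using cross_eq_0D assms that by blast
qed

lemma coplanar_combination:
  assumes "dot q (cross u w) = 0" "cross u w \<noteq> 0"
  obtains s t where "q = s *s u + t *s w"
proof -
  obtain k where k: "cross u w $ k \<noteq> 0"
    using assms(2) by (auto simp: vec_eq_iff)
  \<comment> \<open>Cramer's rule: for i = k this expands the vanishing determinant of q, u, w along
    row k; for the other i it expands a determinant with a repeated row.\<close>
  have "\<forall>k i. cross u w $ k * q $ i = cross q w $ k * u $ i + cross u q $ k * w $ i"
    using assms(1) unfolding forall_3 cross_nth dot_3
    by (intro conjI) (algebra | simp add: algebra_simps)+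
  then have "q = (cross q w $ k / cross u w $ k) *s u + (cross u q $ k / cross u w $ k) *s w"
    using k by (simp add: vec_eq_iff field_simps)
  then show ?thesis using that by blast
qed

section \<open>Incidence, joining lines and meeting points\<close>

lemma incident_proj_pt [simp]:
  assumes "p \<noteq> 0" "l \<noteq> 0"
  shows "incident (proj_pt p) (proj_pt l) \<longleftrightarrow> dot p l = 0"
  using assms by (simp add: incident.abs_eq dot_def)

lemma proj_pt_neqI:
  assumes "dot p l = 0" "dot q l \<noteq> 0" "p \<noteq> 0"
  shows "proj_pt p \<noteq> proj_pt q"
proof -
  have "q \<noteq> 0" "l \<noteq> 0" using assms by auto
  then show ?thesis using assms by (metis incident_proj_pt)
qed

text \<open>Two independent vectors p, q in S make both l and any competing m multiples of
  \<open>cross p q\<close>, so the definite description is determined.\<close>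

lemma line_containing_eqI:
  assumes "proj_pt p \<in> S" "proj_pt q \<in> S" "cross p q \<noteq> 0" "l \<noteq> 0"
    and "\<And>P. P \<in> S \<Longrightarrow> incident P (proj_pt l)"
  shows "line_containing S = proj_pt l"
  unfolding line_containing_def
proof (rule the_equality)
  show "\<forall>P\<in>S. incident P (proj_pt l)" using assms by blast
  fix L assume L: "\<forall>P\<in>S. incident P L"
  obtain m where m: "m \<noteq> 0" "L = proj_pt m" by (rule proj_ptE)
  have nz: "p \<noteq> 0" "q \<noteq> 0" using assms(3) by auto
  have "dot p m = 0" "dot q m = 0" "dot p l = 0" "dot q l = 0"
    using L m nz assms by (metis incident_proj_pt)+
  then obtain c d where "m = c *s cross p q" "l = d *s cross p q"
    using assms(3) by (metis orthogonal_both)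
  then show "L = proj_pt l"
    using m assms(4) by (metis proj_pt_smult vector_mul_eq_0)
qed

lemma line_containing_pair:
  assumes "cross p q \<noteq> 0"
  shows "line_containing {proj_pt p, proj_pt q} = proj_pt (cross p q)"
proof -
  have "p \<noteq> 0" "q \<noteq> 0" using assms by auto
  then show ?thesis by (intro line_containing_eqI[of p _ q]) (use assms in auto)
qed

lemma meet_eqI:
  assumes "dot p l = 0" "dot p m = 0" "cross l m \<noteq> 0" "p \<noteq> 0"
  shows "meet (proj_pt l) (proj_pt m) = proj_pt p"
  unfolding meet_def
proof (rule the_equality)
  have nz: "l \<noteq> 0" "m \<noteq> 0" using assms(3) by auto
  then show "incident (proj_pt p) (proj_pt l) \<and> incident (proj_pt p) (proj_pt m)"
    using assms by simp
  fix Q assume Q: "incident Q (proj_pt l) \<and> incident Q (proj_pt m)"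
  obtain q where q: "q \<noteq> 0" "Q = proj_pt q" by (rule proj_ptE)
  have "dot l q = 0" "dot m q = 0" "dot l p = 0" "dot m p = 0"
    using assms Q q nz by (auto simp: dot_def mult.commute)
  then obtain c d where "q = c *s cross l m" "p = d *s cross l m"
    using assms(3) by (metis orthogonal_both)
  then show "Q = proj_pt p"
    using q assms(4) by (metis proj_pt_smult vector_mul_eq_0)
qed

section \<open>Cross-ratios\<close>

text \<open>\<open>det2\<close> becomes the coefficient of a fixed normal vector of the image line;
  this is how cross-ratios are read off in the plane.\<close>

lemma cross_matrix_vector:
  fixes M :: "'a::field^2^3"
  shows "cross (M *v x) (M *v y) = det2 x y *s cross (column 1 M) (column 2 M)"
  by (simp add: vec3_simps det2_def matrix_vector_mult_def sum_2 column_def algebra_simps)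

lemma cross_combination:
  "cross (s *s e + t *s f) (s' *s e + t' *s f) = (s * t' - s' * t) *s cross e f"
  by (simp add: vec3_simps algebra_simps)

lemma cross_ratio1_proj_pt:
  assumes "x1 \<noteq> 0" "x2 \<noteq> 0" "x3 \<noteq> 0" "x4 \<noteq> 0"
  shows "cross_ratio1 (proj_pt x1) (proj_pt x2) (proj_pt x3) (proj_pt x4) =
    (det2 x1 x3 * det2 x2 x4) / (det2 x2 x3 * det2 x1 x4)"
  using assms by (simp add: cross_ratio1.abs_eq)

text \<open>The coordinates coming from phi and those in the basis e, f have proportional
  determinants, up to one scalar per point. Each point occurs once above and once below the fraction
  bar, so all scalars cancel.\<close>

lemma cross_ratio_unique:
  fixes e f :: "'a::field^3"
  assumes "cross e f \<noteq> 0" "det2 x1 x3 \<noteq> 0"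
    and nz: "x1 \<noteq> 0" "x2 \<noteq> 0" "x3 \<noteq> 0" "x4 \<noteq> 0"
    and phi: "proj_line_iso \<phi>"
    and "\<phi> X1 = proj_pt (x1 $ 1 *s e + x1 $ 2 *s f)" "\<phi> X2 = proj_pt (x2 $ 1 *s e + x2 $ 2 *s f)"
      "\<phi> X3 = proj_pt (x3 $ 1 *s e + x3 $ 2 *s f)" "\<phi> X4 = proj_pt (x4 $ 1 *s e + x4 $ 2 *s f)"
  shows "cross_ratio1 X1 X2 X3 X4 = (det2 x1 x3 * det2 x2 x4) / (det2 x2 x3 * det2 x1 x4)"
proof -
  define pt where "pt x = x $ 1 *s e + x $ 2 *s f" for x :: "'a^2"
  have pt_cross: "cross (pt x) (pt y) = det2 x y *s cross e f" for x y
    unfolding pt_def cross_combination det2_def by (simp add: mult.commute)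
  have pt_nz: "pt x \<noteq> 0" if "x \<noteq> 0" for x
  proof
    assume "pt x = 0"
    then have "det2 x y = 0" for y using pt_cross[of x y] assms(1) by simp
    from this[of "vector [1, 0]"] this[of "vector [0, 1]"] have "x = 0"
      by (simp add: det2_def vec_eq_iff forall_2)
    then show False using that by simp
  qed
  obtain M :: "'a^2^3" where M: "inj ((*v) M)" "\<And>z. z \<noteq> 0 \<Longrightarrow> \<phi> (proj_pt z) = proj_pt (M *v z)"
    using phi unfolding proj_line_iso_def by blast
  define n where "n = cross (column 1 M) (column 2 M)"
  have lift: "\<exists>z c. z \<noteq> 0 \<and> X = proj_pt z \<and> c \<noteq> 0 \<and> M *v z = c *s pt x"
    if "\<phi> X = proj_pt (pt x)" "x \<noteq> 0" for X x
  proof -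
    obtain z where z: "z \<noteq> 0" "X = proj_pt z" by (rule proj_ptE)
    have "M *v z \<noteq> 0"
      using M(1) z(1) by (metis injD matrix_vector_mult_0_right)
    moreover have "proj_pt (pt x) = proj_pt (M *v z)" using that z M(2) by simp
    ultimately show ?thesis using z proj_pt_eq_iff[OF pt_nz[OF that(2)]] by blast
  qed
  obtain z1 c1 where 1: "z1 \<noteq> 0" "X1 = proj_pt z1" "c1 \<noteq> 0" "M *v z1 = c1 *s pt x1"
    using lift nz assms(8-11) unfolding pt_def by metis
  obtain z2 c2 where 2: "z2 \<noteq> 0" "X2 = proj_pt z2" "c2 \<noteq> 0" "M *v z2 = c2 *s pt x2"
    using lift nz assms(8-11) unfolding pt_def by metis
  obtain z3 c3 where 3: "z3 \<noteq> 0" "X3 = proj_pt z3" "c3 \<noteq> 0" "M *v z3 = c3 *s pt x3"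
    using lift nz assms(8-11) unfolding pt_def by metis
  obtain z4 c4 where 4: "z4 \<noteq> 0" "X4 = proj_pt z4" "c4 \<noteq> 0" "M *v z4 = c4 *s pt x4"
    using lift nz assms(8-11) unfolding pt_def by metis
  have rel: "det2 z z' *s n = (c * c' * det2 x x') *s cross e f"
    if "M *v z = c *s pt x" "M *v z' = c' *s pt x'" for z z' c c' x x'
    using cross_matrix_vector[of M z z'] that pt_cross[of x x']
    by (simp add: n_def cross_smult vector_smult_assoc)
  obtain k where k: "cross e f $ k \<noteq> 0"
    using assms(1) by (auto simp: vec_eq_iff)
  \<comment> \<open>The ratio of two normals of the same line, read off in a coordinate where
    \<open>cross e f\<close> is nonzero.\<close>
  define \<kappa> where "\<kappa> = n $ k / cross e f $ k"
  have rel': "\<kappa> * det2 z z' = c * c' * det2 x x'"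
    if "M *v z = c *s pt x" "M *v z' = c' *s pt x'" for z z' c c' x x'
    using arg_cong[where f = "\<lambda>v. v $ k", OF rel[OF that]] k by (simp add: \<kappa>_def field_simps)
  have "\<kappa> \<noteq> 0" using rel'[OF 1(4) 3(4)] assms(2) 1(3) 3(3) by auto
  have "cross_ratio1 X1 X2 X3 X4 = (det2 z1 z3 * det2 z2 z4) / (det2 z2 z3 * det2 z1 z4)"
    using 1 2 3 4 by (simp add: cross_ratio1_proj_pt)
  also have "\<dots> = ((\<kappa> * det2 z1 z3) * (\<kappa> * det2 z2 z4)) / ((\<kappa> * det2 z2 z3) * (\<kappa> * det2 z1 z4))"
    using \<open>\<kappa> \<noteq> 0\<close> by (simp add: mult_ac)
  also have "\<dots> = (det2 x1 x3 * det2 x2 x4) / (det2 x2 x3 * det2 x1 x4)"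
    unfolding rel'[OF 1(4) 3(4)] rel'[OF 2(4) 4(4)] rel'[OF 2(4) 3(4)] rel'[OF 1(4) 4(4)]
    using 1(3) 2(3) 3(3) 4(3) by (simp add: mult_ac)
  finally show ?thesis .
qed

lemma proj_line_iso_combination:
  fixes e f :: "'a::field^3"
  assumes "cross e f \<noteq> 0"
  obtains \<phi> where "proj_line_iso \<phi>"
    and "\<And>x. x \<noteq> 0 \<Longrightarrow> \<phi> (proj_pt x) = proj_pt (x $ 1 *s e + x $ 2 *s f)"
proof
  define M :: "'a^2^3" where "M = (\<chi> i j. if j = 1 then e $ i else f $ i)"
  define \<phi> :: "'a proj_line \<Rightarrow> 'a proj_plane" where "\<phi> X = proj_pt (M *v proj_rep X)" for X
  have M: "M *v x = x $ 1 *s e + x $ 2 *s f" for x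
    by (simp add: M_def matrix_vector_mult_def sum_2 vec_eq_iff mult.commute)
  have col: "column 1 M = e" "column 2 M = f"
    by (simp_all add: M_def column_def vec_eq_iff)
  have ker: "x = 0" if "M *v x = 0" for x
  proof -
    have "det2 x y = 0" for y
      using cross_matrix_vector[of M x y] that assms by (simp add: col)
    from this[of "vector [1, 0]"] this[of "vector [0, 1]"] show "x = 0"
      by (simp add: det2_def vec_eq_iff forall_2)
  qed
  have phi: "\<phi> (proj_pt x) = proj_pt (M *v x)" if x: "x \<noteq> 0" for x
  proof -
    obtain c where "c \<noteq> 0" "proj_rep (proj_pt x) = c *s x"
      using x by (rule proj_rep_proj_pt)
    then show ?thesis
      using ker x unfolding \<phi>_def by (metis proj_pt_smult vector_scalar_commute)
  qed
  have "inj ((*v) M)"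
    using ker by (intro injI) (metis matrix_vector_mult_diff_distrib right_minus_eq)
  then show "proj_line_iso \<phi>" unfolding proj_line_iso_def using phi by blast
  show "\<phi> (proj_pt x) = proj_pt (x $ 1 *s e + x $ 2 *s f)" if "x \<noteq> 0" for x
    using phi[OF that] M by simp
qed

text \<open>The isomorphism attached to e, f provides a value, and \<open>cross_ratio_unique\<close>
  shows that every other choice provides the same one.\<close>

lemma cross_ratio_eq:
  fixes e f :: "'a::field^3"
  assumes "cross e f \<noteq> 0" "det2 x1 x3 \<noteq> 0"
    and nz: "x1 \<noteq> 0" "x2 \<noteq> 0" "x3 \<noteq> 0" "x4 \<noteq> 0"
  shows "cross_ratio
      (proj_pt (x1 $ 1 *s e + x1 $ 2 *s f)) (proj_pt (x2 $ 1 *s e + x2 $ 2 *s f))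
      (proj_pt (x3 $ 1 *s e + x3 $ 2 *s f)) (proj_pt (x4 $ 1 *s e + x4 $ 2 *s f)) =
    (det2 x1 x3 * det2 x2 x4) / (det2 x2 x3 * det2 x1 x4)"
proof -
  obtain \<phi> where "proj_line_iso \<phi>"
    and "\<And>x. x \<noteq> 0 \<Longrightarrow> \<phi> (proj_pt x) = proj_pt (x $ 1 *s e + x $ 2 *s f)"
    using assms(1) by (rule proj_line_iso_combination) blast
  then show ?thesis
    unfolding cross_ratio_def
    by (intro the_equality)
      (use nz in \<open>force simp: cross_ratio1_proj_pt[symmetric]\<close>,
       use cross_ratio_unique[OF assms] in blast)
qed

text \<open>w is the point at infinity of the affine parameter, so the two factors containing it are
  1 and a ratio of differences remains.\<close>

lemma cross_ratio_pencil:
  assumes "cross u w \<noteq> 0" "a1 \<noteq> a3"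
  shows "cross_ratio (proj_pt (u + a1 *s w)) (proj_pt (u + a2 *s w))
    (proj_pt (u + a3 *s w)) (proj_pt w) = (a3 - a1) / (a3 - a2)"
  using cross_ratio_eq[of u w "vector [1, a1]" "vector [1, a3]" "vector [1, a2]" "vector [0, 1]"] assms
  by (simp add: det2_def vec_eq_iff forall_2)

section \<open>Coordinates on a Pappus structure\<close>

text \<open>The product of the Lagrange resolvents p(a) = a_1 + \<omega> a_2 + \<omega>^2 a_3 and
  q(a) = a_1 + \<omega>^2 a_2 + \<omega> a_3, with \<omega> a primitive cube root of unity.\<close>

definition quad :: "(3 \<Rightarrow> 'a::field) \<Rightarrow> 'a"
  where "quad a = (a 1)^2 + (a 2)^2 + (a 3)^2 - a 1 * a 2 - a 2 * a 3 - a 3 * a 1"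

definition vandermonde :: "(3 \<Rightarrow> 'a::field) \<Rightarrow> 'a"
  where "vandermonde a = (a 1 - a 2) * (a 2 - a 3) * (a 3 - a 1)"

definition j_triple :: "(3 \<Rightarrow> 'a::field) \<Rightarrow> 'a"
  where "j_triple a = 4 * quad a ^ 3 / (27 * (vandermonde a)^2)"

text \<open>Homogenised in p and q. For p = 0 or p = q both sides are quotients by 0, hence
  0.\<close>

lemma j_inv_divide:
  assumes "q \<noteq> 0"
  shows "j_inv (p / q) = 4 * (p^2 - p * q + q^2)^3 / (27 * (p * q * (p - q))^2)"
proof -
  have 1: "(p / q)^2 - p / q + 1 = (p^2 - p * q + q^2) / q^2"
    using assms by (simp add: field_simps power2_eq_square)
  have 2: "p / q - 1 = (p - q) / q"
    using assms by (simp add: field_simps)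
  have "j_inv (p / q) = (4 * (p^2 - p * q + q^2)^3 / q^6) / (27 * (p * (p - q))^2 / q^4)"
    unfolding j_inv_def 1 2 by (simp add: power_divide power_mult_distrib mult_ac flip: power_mult power_add)
  also have "\<dots> = 4 * (p^2 - p * q + q^2)^3 * q^4 / (27 * (p * (p - q))^2 * q^6)"
    by (simp add: mult_ac)
  also have "27 * (p * (p - q))^2 * q^6 = (27 * (p * q * (p - q))^2) * q^4"
    by (simp add: power_mult_distrib eval_nat_numeral)
  finally show ?thesis using assms by simp
qed

lemma j_inv_cross_ratio:
  assumes "inj a"
  shows "j_inv ((a 3 - a 1) / (a 3 - a 2)) = j_triple a"
proof -
  have "a 3 - a 2 \<noteq> 0" using injD[OF assms, of 3 2] by auto
  have e: "(a 3 - a 1)^2 - (a 3 - a 1) * (a 3 - a 2) + (a 3 - a 2)^2 = quad a"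
    by (simp add: quad_def power2_eq_square algebra_simps)
  have "(a 3 - a 1) * (a 3 - a 2) * ((a 3 - a 1) - (a 3 - a 2)) = vandermonde a"
    by (simp add: vandermonde_def algebra_simps)
  with e show ?thesis
    by (simp only: j_inv_divide[OF \<open>a 3 - a 2 \<noteq> 0\<close>] j_triple_def)
qed

text \<open>S_3 acts on the indices as the affine group of Z/3, with slope 1 or -1. As 3 = 0, the
  constant is the value at 3.\<close>

lemma inj_3_cases:
  fixes \<pi> :: "3 \<Rightarrow> 3"
  assumes "inj \<pi>"
  obtains c where "\<pi> = (\<lambda>i. i + c)" | c where "\<pi> = (\<lambda>i. c - i)"
proof -
  have ne: "\<pi> 1 \<noteq> \<pi> 2" "\<pi> 2 \<noteq> \<pi> 3" "\<pi> 1 \<noteq> \<pi> 3"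
    using injD[OF assms] by fastforce+
  have "(\<forall>i. \<pi> i = i + (\<pi> 3)) \<or> (\<forall>i. \<pi> i = \<pi> 3 - i)"
    using ne exhaust_3[of "\<pi> 1"] exhaust_3[of "\<pi> 2"] exhaust_3[of "\<pi> 3"]
    by (auto simp: forall_3)
  then show ?thesis using that by fast
qed

lemma index_3:
  "(1::3) + 1 = 2" "(2::3) + 1 = 3" "(3::3) + 1 = 1"
  "(1::3) + 2 = 3" "(2::3) + 2 = 1" "(3::3) + 2 = 2"
  "(1::3) + 3 = 1" "(2::3) + 3 = 2" "(3::3) + 3 = 3"
  "(1::3) - 1 = 3" "(2::3) - 1 = 1" "(3::3) - 1 = 2"
  "(1::3) - 2 = 2" "(2::3) - 2 = 3" "(3::3) - 2 = 1"
  "(1::3) - 3 = 1" "(2::3) - 3 = 2" "(3::3) - 3 = 3"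
  by simp_all

text \<open>Rotations fix \<open>quad\<close> and \<open>vandermonde\<close>; reflections change the
  sign of \<open>vandermonde\<close>, which enters squared.\<close>

lemma j_triple_permute:
  assumes "inj \<pi>"
  shows "j_triple (a \<circ> \<pi>) = j_triple a"
  using assms
proof (cases rule: inj_3_cases)
  case (1 c)
  have "quad (a \<circ> \<pi>) = quad a"
    using exhaust_3[of c] unfolding 1 quad_def comp_def
    by (elim disjE) (simp_all only: index_3, simp_all add: algebra_simps)
  moreover have "vandermonde (a \<circ> \<pi>) = vandermonde a"
    using exhaust_3[of c] unfolding 1 vandermonde_def comp_def
    by (elim disjE) (simp_all only: index_3, simp_all add: algebra_simps)
  ultimately show ?thesis by (simp add: j_triple_def)
next
  case (2 c)
  have "quad (a \<circ> \<pi>) = quad a"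
    using exhaust_3[of c] unfolding 2 quad_def comp_def
    by (elim disjE) (simp_all only: index_3, simp_all add: algebra_simps)
  moreover have "vandermonde (a \<circ> \<pi>) = - vandermonde a"
    using exhaust_3[of c] unfolding 2 vandermonde_def comp_def
    by (elim disjE) (simp_all only: index_3, simp_all add: algebra_simps)
  ultimately show ?thesis by (simp add: j_triple_def)
qed

text \<open>The basis \<open>u, v, w\<close> is adapted to the structure: \<open>w\<close> represents the vertex, and the affine
  parameters \<open>a\<close>, \<open>b\<close> put the vertex at infinity on both lines.\<close>

locale pappus_frame =
  fixes u v w :: "'a::field^3" and a b :: "3 \<Rightarrow> 'a" and A B :: "3 \<Rightarrow> 'a proj_plane"
  assumes basis: "det3 u v w \<noteq> 0"
    and inj_a: "inj a" and inj_b: "inj b"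
    and A_eq: "\<And>i. A i = proj_pt (u + a i *s w)"
    and B_eq: "\<And>i. B i = proj_pt (v + b i *s w)"
begin

text \<open>The two lines play the same role, so interpreting the swapped frame gives each fact
  about A for B as well.\<close>

lemma swap: "pappus_frame v u w b a B A"
proof
  have "det3 v u w = - det3 u v w" by (simp add: vec3_simps algebra_simps)
  then show "det3 v u w \<noteq> 0" using basis by simp
qed (simp_all add: inj_a inj_b A_eq B_eq)

lemma permute:
  assumes "inj \<pi>" "inj \<rho>"
  shows "pappus_frame u v w (a \<circ> \<pi>) (b \<circ> \<rho>) (A \<circ> \<pi>) (B \<circ> \<rho>)"
  by standard (simp_all add: assms inj_a inj_b A_eq B_eq basis inj_compose)

lemma triple_products:
  "dot u (cross v w) = det3 u v w" "dot v (cross u w) = - det3 u v w" "dot w (cross u v) = det3 u v w"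
  by (simp_all add: vec3_simps algebra_simps)

lemma w_neq_0: "w \<noteq> 0"
  using basis by (auto simp: det3_def)

lemma cross_u_w: "cross u w \<noteq> 0"
  using basis triple_products(2) by auto

lemma A_vec_neq_0: "u + t *s w \<noteq> 0"
proof -
  have "dot (u + t *s w) (cross v w) \<noteq> 0"
    using basis by (simp add: triple_products)
  then show ?thesis by (metis dot_0(1))
qed

lemma a_eq_iff: "a i = a j \<longleftrightarrow> i = j"
  using inj_a by (auto dest: injD)

lemma cross_A_A: "cross (u + s *s w) (u + t *s w) = (t - s) *s cross u w"
  by (simp add: vec3_simps algebra_simps)

lemma inj_A: "inj A"
proof (rule injI, rule ccontr)
  fix i j assume *: "A i = A j" "i \<noteq> j"
  then obtain c where "u + a j *s w = c *s (u + a i *s w)"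
    using A_eq A_vec_neq_0 proj_pt_eq_iff by metis
  then have "cross (u + a i *s w) (u + a j *s w) = 0"
    by (simp add: vec3_simps algebra_simps)
  then show False using * cross_u_w a_eq_iff by (simp add: cross_A_A)
qed

lemma line_A: "line_containing (range A) = proj_pt (cross u w)"
proof (rule line_containing_eqI)
  show "proj_pt (u + a 1 *s w) \<in> range A" "proj_pt (u + a 2 *s w) \<in> range A"
    by (simp_all flip: A_eq)
  show "cross (u + a 1 *s w) (u + a 2 *s w) \<noteq> 0"
    using cross_u_w a_eq_iff[of 2 1] by (simp add: cross_A_A)
  show "incident P (proj_pt (cross u w))" if "P \<in> range A" for P
    using that cross_u_w by (auto simp: A_eq A_vec_neq_0)
qed (rule cross_u_w)

lemma vertex_notin_A: "proj_pt w \<notin> range A"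
proof -
  have "proj_pt w \<noteq> proj_pt (u + a i *s w)" for i
    by (rule proj_pt_neqI[of _ "cross v w"]) (use basis w_neq_0 in \<open>simp_all add: triple_products\<close>)
  then show ?thesis by (auto simp: A_eq)
qed

lemma A_neq_B: "A i \<noteq> B j"
proof -
  have "proj_pt (u + a i *s w) \<noteq> proj_pt (v + b j *s w)"
    by (rule proj_pt_neqI[of _ "cross u w"]) (use basis A_vec_neq_0 in \<open>simp_all add: triple_products\<close>)
  then show ?thesis by (simp add: A_eq B_eq)
qed

lemma collinear_A: "proj_collinear (range A)"
  unfolding proj_collinear_def using cross_u_w
  by (intro exI[of _ "proj_pt (cross u w)"]) (auto simp: A_eq A_vec_neq_0)

lemma vertex_eq: "vertex A B = proj_pt w"
proof -
  interpret B: pappus_frame v u w b a B A by (rule swap)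
  show ?thesis unfolding vertex_def line_A B.line_A
  proof (rule meet_eqI)
    have "cross (cross u w) (cross v w) = (det3 u v w) *s w"
      by (simp add: vec3_simps algebra_simps)
    then show "cross (cross u w) (cross v w) \<noteq> 0" using basis w_neq_0 by simp
  qed (simp_all add: w_neq_0)
qed

lemma labelling: "pappus_labelling {range A, range B} A B"
proof -
  interpret B: pappus_frame v u w b a B A by (rule swap)
  have "line_containing (range A) \<noteq> line_containing (range B)"
  proof -
    have "\<not> incident (A 1) (proj_pt (cross v w))" "incident (A 1) (proj_pt (cross u w))"
      using basis cross_u_w B.cross_u_w A_vec_neq_0 by (simp_all add: A_eq triple_products)
    then show ?thesis unfolding line_A B.line_A by metis
  qed
  then show ?thesis
    unfolding pappus_labelling_def vertex_eq
    using inj_A B.inj_A A_neq_B collinear_A B.collinear_A vertex_notin_A B.vertex_notin_A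
    by auto
qed

lemma j_inv_A: "j_inv (cross_ratio (A 1) (A 2) (A 3) (vertex A B)) = j_triple a"
  unfolding vertex_eq A_eq
  by (subst cross_ratio_pencil)
    (use cross_u_w a_eq_iff[of 1 3] in \<open>simp_all add: j_inv_cross_ratio inj_a\<close>)

lemma vertex_swap: "vertex B A = vertex A B"
  using vertex_eq pappus_frame.vertex_eq[OF swap] by simp

text \<open>The only freedom is reordering within the triples and exchanging them; well-definedness
  of \<open>signature\<close> and \<open>steiner\<close> is reduced to these two moves.\<close>

lemma other_labelling:
  assumes "pappus_labelling {range A, range B} A' B'"
  obtains \<pi> \<rho> where "inj \<pi>" "inj \<rho>" "A' = A \<circ> \<pi>" "B' = B \<circ> \<rho>"
    | \<pi> \<rho> where "inj \<pi>" "inj \<rho>" "A' = B \<circ> \<pi>" "B' = A \<circ> \<rho>"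
proof -
  have reindex: "\<exists>\<pi>. inj \<pi> \<and> X' = X \<circ> \<pi>"
    if "inj X'" "range X' = range X" for X X' :: "3 \<Rightarrow> 'a proj_plane"
  proof -
    have "\<forall>i. \<exists>k. X' i = X k" using that by (metis rangeE rangeI)
    then obtain \<pi> where "X' = X \<circ> \<pi>" by (metis comp_apply ext)
    then show ?thesis using that(1) inj_on_imageI2 by blast
  qed
  have "inj A'" "inj B'" and "{range A, range B} = {range A', range B'}"
    using assms by (auto simp: pappus_labelling_def)
  then show ?thesis
    using reindex that by (metis (no_types, lifting) doubleton_eq_iff)
qed

lemma signature_eq: "signature {range A, range B} = (j_triple a + j_triple b, j_triple a * j_triple b)"
  unfolding signature_def
proof (rule the_equality)
  interpret B: pappus_frame v u w b a B A by (rule swap)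
  have j: "j_inv (cross_ratio (B 1) (B 2) (B 3) (vertex A B)) = j_triple b"
    using B.j_inv_A vertex_swap by simp
  show "\<exists>A' B' r s. pappus_labelling {range A, range B} A' B' \<and>
       r = cross_ratio (A' 1) (A' 2) (A' 3) (vertex A' B') \<and>
       s = cross_ratio (B' 1) (B' 2) (B' 3) (vertex A' B') \<and>
       (j_triple a + j_triple b, j_triple a * j_triple b) = (j_inv r + j_inv s, j_inv r * j_inv s)"
    using labelling j j_inv_A by metis
  fix z
  assume "\<exists>A' B' r s. pappus_labelling {range A, range B} A' B' \<and>
       r = cross_ratio (A' 1) (A' 2) (A' 3) (vertex A' B') \<and>
       s = cross_ratio (B' 1) (B' 2) (B' 3) (vertex A' B') \<and>
       z = (j_inv r + j_inv s, j_inv r * j_inv s)"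
  then obtain A' B' where lab: "pappus_labelling {range A, range B} A' B'"
    and z: "z = (j_inv (cross_ratio (A' 1) (A' 2) (A' 3) (vertex A' B')) +
          j_inv (cross_ratio (B' 1) (B' 2) (B' 3) (vertex A' B')),
        j_inv (cross_ratio (A' 1) (A' 2) (A' 3) (vertex A' B')) *
          j_inv (cross_ratio (B' 1) (B' 2) (B' 3) (vertex A' B')))"
    by blast
  from lab show "z = (j_triple a + j_triple b, j_triple a * j_triple b)"
  proof (cases rule: other_labelling)
    case (1 \<pi> \<rho>)
    interpret F: pappus_frame u v w "a \<circ> \<pi>" "b \<circ> \<rho>" A' B'
      unfolding 1 using 1 by (intro permute)
    show ?thesis
      using z F.j_inv_A pappus_frame.j_inv_A[OF F.swap] F.vertex_swap 1 by (simp add: j_triple_permute)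
  next
    case (2 \<pi> \<rho>)
    interpret F: pappus_frame v u w "b \<circ> \<pi>" "a \<circ> \<rho>" A' B'
      unfolding 2 using 2 by (intro B.permute)
    show ?thesis
      using z F.j_inv_A pappus_frame.j_inv_A[OF F.swap] F.vertex_swap 2
      by (simp add: j_triple_permute add.commute mult.commute)
  qed
qed

end

text \<open>In p = s u + t w the coefficient s is nonzero because p and w are different points, so
  it can be scaled to 1.\<close>

lemma pencil_coordinates:
  fixes l u w :: "'a::field^3"
  assumes "\<And>i. incident (P i) (proj_pt l)" "\<And>i. P i \<noteq> proj_pt w" "P k = proj_pt u"
    and "dot w l = 0" "l \<noteq> 0" "u \<noteq> 0" "w \<noteq> 0"
  obtains a where "\<And>i. P i = proj_pt (u + a i *s w)"
proof -
  have uw: "cross u w \<noteq> 0"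
    using assms by (metis cross_neq_0I)
  moreover have "dot u l = 0" using assms by (metis incident_proj_pt)
  ultimately obtain c where c: "l = c *s cross u w"
    using assms(4) orthogonal_both by blast
  have "\<exists>t. P i = proj_pt (u + t *s w)" for i
  proof -
    obtain p where p: "p \<noteq> 0" "P i = proj_pt p" by (rule proj_ptE)
    have "dot p l = 0" using assms(1)[of i] p assms(5) by simp
    then have "dot p (cross u w) = 0" using c assms(5) by auto
    then obtain s t where st: "p = s *s u + t *s w"
      using uw coplanar_combination by blast
    have "s \<noteq> 0"
    proof
      assume "s = 0"
      then have "p = t *s w" "t \<noteq> 0" using st p by auto
      then show False using assms(2)[of i] p assms(7) by simp
    qed
    then have "p = s *s (u + (t / s) *s w)"
      using st by (simp add: vec_eq_iff field_simps)
    then show ?thesis using p \<open>s \<noteq> 0\<close> by (metis proj_pt_smult vector_mul_eq_0)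
  qed
  then show ?thesis using that by metis
qed

text \<open>Any vectors for \<open>A 1\<close> and \<open>B 1\<close> serve as u and v, and the
  cross product of the two lines as w.\<close>

lemma pappus_frame_exists:
  assumes "pappus_labelling \<P> A B"
  obtains u v w a b where "pappus_frame u v w a b A B"
proof -
  have line: "\<exists>l. l \<noteq> 0 \<and> line_containing (range X) = proj_pt l \<and> (\<forall>i. incident (X i) (proj_pt l))"
    if X: "inj X" "proj_collinear (range X)" for X :: "3 \<Rightarrow> 'a proj_plane"
  proof -
    obtain l where l: "l \<noteq> 0" "\<And>i. incident (X i) (proj_pt l)"
      using X(2) unfolding proj_collinear_def by (metis proj_ptE rangeI)
    obtain p q where pq: "p \<noteq> 0" "X 1 = proj_pt p" "q \<noteq> 0" "X 2 = proj_pt q"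
      by (metis proj_ptE)
    have "X 1 \<noteq> X 2" using injD[OF X(1), of 1 2] by auto
    then have "line_containing (range X) = proj_pt l"
      using l pq by (intro line_containing_eqI[of p _ q] cross_neq_0I) (metis rangeI rangeE)+
    then show ?thesis using l by blast
  qed
  obtain l where l: "l \<noteq> 0" "line_containing (range A) = proj_pt l" "\<And>i. incident (A i) (proj_pt l)"
    using line assms unfolding pappus_labelling_def by metis
  obtain m where m: "m \<noteq> 0" "line_containing (range B) = proj_pt m" "\<And>i. incident (B i) (proj_pt m)"
    using line assms unfolding pappus_labelling_def by metis
  define w where "w = cross l m"
  have w: "w \<noteq> 0"
    unfolding w_def using assms l m by (intro cross_neq_0I) (auto simp: pappus_labelling_def)
  then have vertex: "vertex A B = proj_pt w"
    unfolding vertex_def l m w_def by (intro meet_eqI) simp_all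
  have not_vertex: "A i \<noteq> proj_pt w" "B i \<noteq> proj_pt w" for i
    using assms unfolding pappus_labelling_def vertex by (metis UnCI rangeI)+
  obtain u where u: "u \<noteq> 0" "A 1 = proj_pt u" by (rule proj_ptE)
  obtain v where v: "v \<noteq> 0" "B 1 = proj_pt v" by (rule proj_ptE)
  have wl: "dot w l = 0" "dot w m = 0" by (simp_all add: w_def)
  obtain a where a: "\<And>i. A i = proj_pt (u + a i *s w)"
    using pencil_coordinates[of A l w 1 u] l(1,3) not_vertex u w wl by metis
  obtain b where b: "\<And>i. B i = proj_pt (v + b i *s w)"
    using pencil_coordinates[of B m w 1 v] m(1,3) not_vertex v w wl by metis
  have ul: "dot u l = 0" and vm: "dot v m = 0"
    using l m u v by (metis incident_proj_pt)+
  have "det3 u v w \<noteq> 0"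
  proof
    \<comment> \<open>This would put \<open>B 1\<close> on the first line too, and so at the
      vertex.\<close>
    assume det: "det3 u v w = 0"
    have "cross u w \<noteq> 0" using not_vertex(1)[of 1] u w by (intro cross_neq_0I) auto
    moreover from this obtain c where "l = c *s cross u w"
      using ul wl orthogonal_both by blast
    moreover have "dot v (cross u w) = - det3 u v w"
      by (simp add: vec3_simps algebra_simps)
    ultimately have "dot v l = 0" using det by simp
    then obtain d where "v = d *s w"
      using vm w unfolding w_def by (metis dot_commute orthogonal_both)
    then show False using not_vertex(2)[of 1] v w by auto
  qed
  moreover have "inj a" "inj b"
    using assms a b by (auto simp: pappus_labelling_def inj_def)
  ultimately have "pappus_frame u v w a b A B"
    using a b by unfold_locales auto
  then show ?thesis using that by blast
qed

section \<open>Pappus lines\<close>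

definition crossing ::
    "(3 \<Rightarrow> 'a::field proj_plane) \<Rightarrow> (3 \<Rightarrow> 'a proj_plane) \<Rightarrow> (3 \<Rightarrow> 3) \<Rightarrow> 3 \<Rightarrow> 3 \<Rightarrow> 'a proj_plane"
  where "crossing A B \<sigma> i j =
    meet (line_containing {A i, B (\<sigma> j)}) (line_containing {A j, B (\<sigma> i)})"

lemma meet_commute: "meet L M = meet M L"
  by (simp add: meet_def conj_commute)

lemma crossing_commute: "crossing A B \<sigma> i j = crossing A B \<sigma> j i"
  by (simp add: crossing_def meet_commute)

text \<open>Taking all pairs of distinct indices instead of the three listed ones makes the set of
  crossings visibly stable under relabelling.\<close>

lemma pappus_line_eq:
  "pappus_line A B \<sigma> = line_containing {P. \<exists>i j. i \<noteq> j \<and> P = crossing A B \<sigma> i j}"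
proof -
  have "{P. \<exists>i j. i \<noteq> j \<and> P = crossing A B \<sigma> i j} =
    {crossing A B \<sigma> 1 2, crossing A B \<sigma> 2 3, crossing A B \<sigma> 1 3}" (is "?S = ?T")
  proof (rule set_eqI, rule iffI)
    fix P assume "P \<in> ?S"
    then obtain i j where "i \<noteq> j" "P = crossing A B \<sigma> i j" by blast
    then show "P \<in> ?T"
      using exhaust_3[of i] exhaust_3[of j] crossing_commute[of A B \<sigma>] by (metis insertCI)
  next
    fix P assume "P \<in> ?T"
    moreover have "(1::3) \<noteq> 2" "(2::3) \<noteq> 3" "(1::3) \<noteq> 3" by simp_all
    ultimately show "P \<in> ?S" by blast
  qed
  then show ?thesis by (simp add: pappus_line_def crossing_def)
qed

text \<open>A Pappus line depends only on the matching of \<open>A i\<close> with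
  \<open>B (\<sigma> i)\<close>; renaming the indices permutes the crossings.\<close>

lemma pappus_line_reindex:
  assumes "inj \<tau>" "\<And>i. B' (\<sigma> i) = B (\<sigma>' (\<tau> i))"
  shows "pappus_line (A \<circ> \<tau>) B' \<sigma> = pappus_line A B \<sigma>'"
proof -
  have "surj \<tau>" using assms(1) by (rule finite_UNIV_inj_surj[OF finite])
  have c: "crossing (A \<circ> \<tau>) B' \<sigma> i j = crossing A B \<sigma>' (\<tau> i) (\<tau> j)" for i j
    using assms(2) by (simp add: crossing_def)
  have "{P. \<exists>i j. i \<noteq> j \<and> P = crossing (A \<circ> \<tau>) B' \<sigma> i j} =
      {P. \<exists>i j. i \<noteq> j \<and> P = crossing A B \<sigma>' i j}"
    unfolding c using assms(1) \<open>surj \<tau>\<close> by (intro Collect_cong) (metis injD surjD)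
  then show ?thesis by (simp add: pappus_line_eq)
qed

text \<open>Exchanging the triples replaces the matching by its inverse.\<close>

lemma pappus_line_swap:
  assumes "\<And>i. \<sigma>' (\<sigma> i) = i" "\<And>i. \<sigma> (\<sigma>' i) = i"
  shows "pappus_line B A \<sigma> = pappus_line A B \<sigma>'"
proof -
  have c: "crossing B A \<sigma> i j = crossing A B \<sigma>' (\<sigma> i) (\<sigma> j)" for i j
    unfolding crossing_def assms by (subst meet_commute) (simp add: insert_commute)
  have "{P. \<exists>i j. i \<noteq> j \<and> P = crossing B A \<sigma> i j} =
      {P. \<exists>i j. i \<noteq> j \<and> P = crossing A B \<sigma>' i j}"
    unfolding c using assms by (intro Collect_cong) metis
  then show ?thesis by (simp add: pappus_line_eq)
qed

text \<open>With indices in \<open>\<int>/3\<close>, the even permutations are \<open>i \<mapsto> i + c\<close> and the odd ones \<open>i \<mapsto> c - i\<close>.\<close>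

definition pappus_lines :: "(3 \<Rightarrow> 'a::field proj_plane) \<Rightarrow> (3 \<Rightarrow> 'a proj_plane) \<Rightarrow> 'a dual_plane set set"
  where "pappus_lines A B =
    {range (\<lambda>c. pappus_line A B (\<lambda>i. i + c)), range (\<lambda>c. pappus_line A B (\<lambda>i. c - i))}"

lemma cycles_3:
  "id = (\<lambda>i::3. i + 3)"
  "cycle_of_list [1, 2, 3] = (\<lambda>i::3. i + 1)"
  "cycle_of_list [1, 3, 2] = (\<lambda>i::3. i + 2)"
  "cycle_of_list [1, 2] = (\<lambda>i::3. 3 - i)"
  "cycle_of_list [1, 3] = (\<lambda>i::3. 1 - i)"
  "cycle_of_list [2, 3] = (\<lambda>i::3. 2 - i)"
  unfolding fun_eq_iff forall_3 by (simp_all add: Transposition.transpose_def)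

lemma range_3: "range f = {f 1, f 2, f (3::3)}"
  by (simp add: UNIV_3)

lemma pappus_lines_alt:
  "{{pappus_line A B id, pappus_line A B (cycle_of_list [1, 2, 3]),
     pappus_line A B (cycle_of_list [1, 3, 2])},
    {pappus_line A B (cycle_of_list [1, 2]), pappus_line A B (cycle_of_list [1, 3]),
     pappus_line A B (cycle_of_list [2, 3])}} = pappus_lines A B"
  unfolding pappus_lines_def range_3 cycles_3 by (simp add: insert_commute)

lemma range_reindex:
  assumes "\<And>c. f c = g (h c)" "surj h"
  shows "range f = range g"
  using assms by (metis ext image_image)

lemma surj_affine: "surj (\<lambda>c::3. c + d)" "surj (\<lambda>c::3. d + c)" "surj (\<lambda>c::3. c - d)" "surj (\<lambda>c::3. d - c)"
  by (rule surjI[of _ "\<lambda>c. c - d"] surjI[of _ "\<lambda>c. c + d"] surjI[of _ "\<lambda>c. d - c"], simp)+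

text \<open>A rotation shifts c inside each family; a reflection exchanges the even and the odd
  family. The unordered pair is the same in both cases.\<close>

lemma pappus_lines_permute_left:
  assumes "inj \<pi>"
  shows "pappus_lines (A \<circ> \<pi>) B = pappus_lines A B"
  using assms
proof (cases rule: inj_3_cases)
  case (1 d)
  have "pappus_line (A \<circ> \<pi>) B (\<lambda>i. i + c) = pappus_line A B (\<lambda>i. i + (c - d))" for c
    by (rule pappus_line_reindex[OF assms]) (simp add: 1)
  moreover have "pappus_line (A \<circ> \<pi>) B (\<lambda>i. c - i) = pappus_line A B (\<lambda>i. (c + d) - i)" for c
    by (rule pappus_line_reindex[OF assms]) (simp add: 1)
  ultimately have
    "range (\<lambda>c. pappus_line (A \<circ> \<pi>) B (\<lambda>i. i + c)) = range (\<lambda>c. pappus_line A B (\<lambda>i. i + c))"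
    "range (\<lambda>c. pappus_line (A \<circ> \<pi>) B (\<lambda>i. c - i)) = range (\<lambda>c. pappus_line A B (\<lambda>i. c - i))"
    using surj_affine by (intro range_reindex; blast)+
  then show ?thesis by (simp add: pappus_lines_def)
next
  case (2 d)
  have "pappus_line (A \<circ> \<pi>) B (\<lambda>i. i + c) = pappus_line A B (\<lambda>i. (d + c) - i)" for c
    by (rule pappus_line_reindex[OF assms]) (simp add: 2 algebra_simps)
  moreover have "pappus_line (A \<circ> \<pi>) B (\<lambda>i. c - i) = pappus_line A B (\<lambda>i. i + (c - d))" for c
    by (rule pappus_line_reindex[OF assms]) (simp add: 2 algebra_simps)
  ultimately have
    "range (\<lambda>c. pappus_line (A \<circ> \<pi>) B (\<lambda>i. i + c)) = range (\<lambda>c. pappus_line A B (\<lambda>i. c - i))"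
    "range (\<lambda>c. pappus_line (A \<circ> \<pi>) B (\<lambda>i. c - i)) = range (\<lambda>c. pappus_line A B (\<lambda>i. i + c))"
    using surj_affine by (intro range_reindex; blast)+
  then show ?thesis by (simp add: pappus_lines_def insert_commute)
qed

lemma pappus_lines_swap: "pappus_lines B A = pappus_lines A B"
proof -
  have "pappus_line B A (\<lambda>i. i + c) = pappus_line A B (\<lambda>i. i + (3 - c))" for c
    by (rule pappus_line_swap) simp_all
  then have "range (\<lambda>c. pappus_line B A (\<lambda>i. i + c)) = range (\<lambda>c. pappus_line A B (\<lambda>i. i + c))"
    using surj_affine by (intro range_reindex; blast)
  moreover have "pappus_line B A (\<lambda>i. c - i) = pappus_line A B (\<lambda>i. c - i)" for c
    by (rule pappus_line_swap) simp_all
  ultimately show ?thesis by (simp add: pappus_lines_def)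
qed

lemma pappus_lines_permute:
  assumes "inj \<pi>" "inj \<rho>"
  shows "pappus_lines (A \<circ> \<pi>) (B \<circ> \<rho>) = pappus_lines A B"
  using assms pappus_lines_permute_left pappus_lines_swap by metis

lemma (in pappus_frame) steiner_eq: "steiner {range A, range B} = pappus_lines A B"
  unfolding steiner_def pappus_lines_alt
proof (rule the_equality)
  show "\<exists>A' B'. pappus_labelling {range A, range B} A' B' \<and> pappus_lines A B = pappus_lines A' B'"
    using labelling by blast
  fix S assume "\<exists>A' B'. pappus_labelling {range A, range B} A' B' \<and> S = pappus_lines A' B'"
  then obtain A' B' where "pappus_labelling {range A, range B} A' B'" and S: "S = pappus_lines A' B'"
    by blast
  then show "S = pappus_lines A B"
    by (cases rule: other_labelling) (simp_all add: pappus_lines_permute pappus_lines_swap)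
qed

text \<open>Coordinates of the line through the three crossings for \<open>\<sigma> = id\<close>: with
  \<open>Q\<^sub>i = (b\<^sub>i, a\<^sub>i, a\<^sub>i b\<^sub>i)\<close> in the basis \<open>u, v, w\<close>, the crossings are the differences
  \<open>Q\<^sub>i - Q\<^sub>j\<close>, which add up to zero around the triangle (this is Pappus's theorem).\<close>

definition line1 :: "(3 \<Rightarrow> 'a::field) \<Rightarrow> (3 \<Rightarrow> 'a) \<Rightarrow> 'a"
  where "line1 a b = a 1 * a 2 * (b 2 - b 1) + a 2 * a 3 * (b 3 - b 2) + a 3 * a 1 * (b 1 - b 3)"

definition line2 :: "(3 \<Rightarrow> 'a::field) \<Rightarrow> (3 \<Rightarrow> 'a) \<Rightarrow> 'a"
  where "line2 a b = b 1 * b 2 * (a 1 - a 2) + b 2 * b 3 * (a 2 - a 3) + b 3 * b 1 * (a 3 - a 1)"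

definition line3 :: "(3 \<Rightarrow> 'a::field) \<Rightarrow> (3 \<Rightarrow> 'a) \<Rightarrow> 'a"
  where "line3 a b = a 2 * b 1 - a 1 * b 2 + a 3 * b 2 - a 2 * b 3 + a 1 * b 3 - a 3 * b 1"

section \<open>Coordinates of the Pappus lines in the adapted basis\<close>

context pappus_frame
begin

definition pt_vec :: "'a \<Rightarrow> 'a \<Rightarrow> 'a \<Rightarrow> 'a^3"
  where "pt_vec x y z = x *s u + y *s v + z *s w"

text \<open>The three cross products are the dual basis of u, v, w multiplied by
  \<open>det3 u v w\<close>.\<close>

definition line_vec :: "'a \<Rightarrow> 'a \<Rightarrow> 'a \<Rightarrow> 'a^3"
  where "line_vec x y z = x *s cross v w + y *s cross w u + z *s cross u v"

definition pappus_vec :: "(3 \<Rightarrow> 3) \<Rightarrow> 'a^3"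
  where "pappus_vec \<sigma> = line_vec (line1 a (b \<circ> \<sigma>)) (line2 a (b \<circ> \<sigma>)) (line3 a (b \<circ> \<sigma>))"

lemma dot_pt_line: "dot (pt_vec x y z) (line_vec x' y' z') = det3 u v w * (x * x' + y * y' + z * z')"
proof -
  have "dot u (cross v w) = det3 u v w" "dot v (cross w u) = det3 u v w" "dot w (cross u v) = det3 u v w"
    by (simp_all add: vec3_simps algebra_simps)
  then show ?thesis by (simp add: pt_vec_def line_vec_def algebra_simps)
qed

lemma cross_pt_pt: "cross (pt_vec x y z) (pt_vec x' y' z') =
    line_vec (y * z' - z * y') (z * x' - x * z') (x * y' - y * x')"
  by (simp add: pt_vec_def line_vec_def vec3_simps algebra_simps)

lemma cross_line_line: "cross (line_vec x y z) (line_vec x' y' z') =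
    det3 u v w *s pt_vec (y * z' - z * y') (z * x' - x * z') (x * y' - y * x')"
  by (simp add: pt_vec_def line_vec_def vec3_simps algebra_simps)

lemma det3_line: "det3 (line_vec x y z) (line_vec x' y' z') (line_vec x'' y'' z'') =
    (det3 u v w)^2 * (x * (y' * z'' - z' * y'') + y * (z' * x'' - x' * z'') + z * (x' * y'' - y' * x''))"
  unfolding det3_def[of "line_vec x y z"] cross_line_line
  by (simp add: dot_commute[of "line_vec x y z"] dot_pt_line power2_eq_square mult_ac)

lemma pt_vec_neq_0: "y \<noteq> 0 \<Longrightarrow> pt_vec x y z \<noteq> 0"
  using dot_pt_line[of x y z 0 1 0] basis by auto

lemma line_A_B: "line_containing {A i, B j} = proj_pt (line_vec (- a i) (- b j) 1)"
proof -
  have c: "cross (u + a i *s w) (v + b j *s w) = line_vec (- a i) (- b j) 1"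
    by (simp add: line_vec_def vec3_simps algebra_simps)
  have "line_vec (- a i) (- b j) 1 \<noteq> 0"
    using dot_pt_line[of 0 0 1 "- a i" "- b j" 1] basis by auto
  then show ?thesis unfolding A_eq B_eq by (simp add: line_containing_pair c)
qed

text \<open>The difference Q_i - Q_j is orthogonal to both joining lines. Its second coordinate a_i
  - a_j is nonzero, which also shows that these lines are distinct.\<close>

lemma crossing_eq:
  assumes "i \<noteq> j"
  shows "crossing A B \<sigma> i j = proj_pt
    (pt_vec (b (\<sigma> i) - b (\<sigma> j)) (a i - a j) (a i * b (\<sigma> i) - a j * b (\<sigma> j)))"
  unfolding crossing_def line_A_B
proof (rule meet_eqI)
  have "a i - a j \<noteq> 0" "a j - a i \<noteq> 0" using assms a_eq_iff by simp_all
  then show "cross (line_vec (- a i) (- b (\<sigma> j)) 1) (line_vec (- a j) (- b (\<sigma> i)) 1) \<noteq> 0"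
    using basis pt_vec_neq_0 by (simp add: cross_line_line)
  show "pt_vec (b (\<sigma> i) - b (\<sigma> j)) (a i - a j) (a i * b (\<sigma> i) - a j * b (\<sigma> j)) \<noteq> 0"
    using \<open>a i - a j \<noteq> 0\<close> by (rule pt_vec_neq_0)
qed (simp_all add: dot_pt_line algebra_simps)

text \<open>The vector of the crossing (1, 3) is the sum of those of (1, 2) and (2, 3), so the cross
  product of the latter two represents the line.\<close>

lemma pappus_line_vec:
  assumes "pappus_vec \<sigma> \<noteq> 0"
  shows "pappus_line A B \<sigma> = proj_pt (pappus_vec \<sigma>)"
  unfolding pappus_line_eq
proof (rule line_containing_eqI)
  define pt where
    "pt i j = pt_vec (b (\<sigma> i) - b (\<sigma> j)) (a i - a j) (a i * b (\<sigma> i) - a j * b (\<sigma> j))" for i j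
  have ne: "(1::3) \<noteq> 2" "(2::3) \<noteq> 3" by simp_all
  show "proj_pt (pt 1 2) \<in> {P. \<exists>i j. i \<noteq> j \<and> P = crossing A B \<sigma> i j}"
    "proj_pt (pt 2 3) \<in> {P. \<exists>i j. i \<noteq> j \<and> P = crossing A B \<sigma> i j}"
    unfolding pt_def using ne by (metis (mono_tags, lifting) crossing_eq mem_Collect_eq)+
  have "cross (pt 1 2) (pt 2 3) = pappus_vec \<sigma>"
    unfolding pt_def cross_pt_pt pappus_vec_def line1_def line2_def line3_def
    by (rule arg_cong3[where f = line_vec]) (simp_all add: algebra_simps)
  then show "cross (pt 1 2) (pt 2 3) \<noteq> 0" using assms by simp
  fix P assume "P \<in> {P. \<exists>i j. i \<noteq> j \<and> P = crossing A B \<sigma> i j}"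
  then obtain i j where ij: "i \<noteq> j" "P = proj_pt (pt i j)"
    unfolding pt_def using crossing_eq by blast
  have "pt i j \<noteq> 0" using ij a_eq_iff unfolding pt_def by (intro pt_vec_neq_0) simp
  moreover have "dot (pt i j) (pappus_vec \<sigma>) = 0"
    unfolding pt_def pappus_vec_def dot_pt_line line1_def line2_def line3_def
    using exhaust_3[of i] exhaust_3[of j] by (elim disjE) (simp_all add: algebra_simps)
  ultimately show "incident P (proj_pt (pappus_vec \<sigma>))" using assms ij by simp
qed (rule assms)

end

section \<open>The dual Pappus structure\<close>

text \<open>The parameters come from \<open>W = l\<^sub>2 L\<^sub>1 - l\<^sub>1 L\<^sub>2 = k\<^sub>1 M\<^sub>2 - k\<^sub>2 M\<^sub>1\<close>, where \<open>W\<close>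
  represents the dual vertex, i.e. the line joining the two Steiner points.\<close>

lemma dual_frame:
  fixes L M :: "3 \<Rightarrow> 'a::field^3"
  defines "l \<equiv> \<lambda>c. det3 (L c) (M 1) (M 2)" and "k \<equiv> \<lambda>c. det3 (M c) (L 1) (L 2)"
  assumes sum: "L 1 + L 2 + L 3 = 0" "M 1 + M 2 + M 3 = 0"
    and nz: "\<And>c. l c \<noteq> 0" "\<And>c. k c \<noteq> 0"
  shows "pappus_frame (L 1) (M 1) (cross (cross (M 1) (M 2)) (cross (L 1) (L 2)))
    (\<lambda>i. if i = 1 then 0 else if i = 2 then - inverse (l 2) else inverse (l 3))
    (\<lambda>i. if i = 1 then 0 else if i = 2 then inverse (k 2) else - inverse (k 3))
    (\<lambda>c. proj_pt (L c)) (\<lambda>c. proj_pt (M c))"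
proof
  define W where "W = cross (cross (M 1) (M 2)) (cross (L 1) (L 2))"
  have L3: "L 3 = - L 1 - L 2" and M3: "M 3 = - M 1 - M 2"
    using sum by (simp_all add: algebra_simps eq_neg_iff_add_eq_0)
  have l3: "l 3 = - l 1 - l 2" and k3: "k 3 = - k 1 - k 2"
    unfolding l_def k_def L3 M3 by (simp_all add: det3_def)
  have W1: "W = l 2 *s L 1 - l 1 *s L 2"
    unfolding W_def cross_cross l_def det3_def by (simp add: dot_commute)
  have "W = - cross (cross (L 1) (L 2)) (cross (M 1) (M 2))"
    unfolding W_def by (rule cross_commute)
  also have "\<dots> = k 1 *s M 2 - k 2 *s M 1"
    unfolding cross_cross k_def det3_def by (simp add: dot_commute)
  finally have W2: "W = k 1 *s M 2 - k 2 *s M 1" .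
  have vec_nz: "L c \<noteq> 0" "M c \<noteq> 0" for c
    using nz[of c] unfolding l_def k_def det3_def by auto
  have pt: "proj_pt q = proj_pt p" if "q = c *s p" "q \<noteq> 0" for q p :: "'a^3" and c
    using that by (metis proj_pt_smult vector_mul_eq_0)
  have "det3 (L 1) (M 1) W = k 1 * l 1"
    unfolding det3_def[of "L 1" "M 1"] W_def cross_cross[of "M 1" "cross (M 1) (M 2)"]
    by (simp add: l_def k_def det3_def)
  then show "det3 (L 1) (M 1) (cross (cross (M 1) (M 2)) (cross (L 1) (L 2))) \<noteq> 0"
    using nz unfolding W_def by simp
  \<comment> \<open>Solve the expression of W for \<open>L 2\<close>, then insert it into L 3 = - L
    1 - L 2 and use l 3 = - l 1 - l 2.\<close>
  have L2: "L 2 = (l 2 / l 1) *s (L 1 + (- inverse (l 2)) *s W)"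
    and L3': "L 3 = (l 3 / l 1) *s (L 1 + inverse (l 3) *s W)"
    using nz(1)[of 1] nz(1)[of 2] nz(1)[of 3] unfolding W1 L3
    by (simp_all add: vec_eq_iff field_simps) (simp add: l3 algebra_simps)
  have M2: "M 2 = (k 2 / k 1) *s (M 1 + inverse (k 2) *s W)"
    and M3': "M 3 = (k 3 / k 1) *s (M 1 + (- inverse (k 3)) *s W)"
    using nz(2)[of 1] nz(2)[of 2] nz(2)[of 3] unfolding W2 M3
    by (simp_all add: vec_eq_iff field_simps) (simp add: k3 algebra_simps)
  show "proj_pt (L i) = proj_pt (L 1 + (if i = 1 then 0 else if i = 2 then - inverse (l 2) else inverse (l 3)) *s
      cross (cross (M 1) (M 2)) (cross (L 1) (L 2)))" for i
    using exhaust_3[of i] pt[OF L2 vec_nz(1)] pt[OF L3' vec_nz(1)] unfolding W_def[symmetric] by auto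
  show "proj_pt (M i) = proj_pt (M 1 + (if i = 1 then 0 else if i = 2 then inverse (k 2) else - inverse (k 3)) *s
      cross (cross (M 1) (M 2)) (cross (L 1) (L 2)))" for i
    using exhaust_3[of i] pt[OF M2 vec_nz(2)] pt[OF M3' vec_nz(2)] unfolding W_def[symmetric] by auto
  \<comment> \<open>Equal parameters would give l 2 + l 3 = 0 or k 2 + k 3 = 0, that is, l 1 = 0 or
    k 1 = 0.\<close>
  have "- inverse (l 2) \<noteq> inverse (l 3)" "inverse (k 2) \<noteq> - inverse (k 3)"
    using nz(1)[of 1] nz(2)[of 1] l3 k3 by (auto simp flip: inverse_minus_eq)
  then show "inj (\<lambda>i::3. if i = 1 then 0 else if i = 2 then - inverse (l 2) else inverse (l 3))"
    "inj (\<lambda>i::3. if i = 1 then 0 else if i = 2 then inverse (k 2) else - inverse (k 3))"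
    using nz exhaust_3 unfolding inj_def by (metis inverse_nonzero_iff_nonzero neg_equal_0_iff_equal)+
qed

text \<open>The two sign patterns, one per family in \<open>dual_frame\<close>, give the same value
  because \<open>quad\<close> and the square of \<open>vandermonde\<close> are even
  functions.\<close>

lemma j_triple_inverse:
  fixes s t :: "'a::field"
  assumes "s \<noteq> 0" "t \<noteq> 0" "a = (\<lambda>i. if i = 1 then 0 else if i = 2 then - inverse s else inverse t) \<or>
    a = (\<lambda>i. if i = 1 then 0 else if i = 2 then inverse s else - inverse t)"
  shows "j_triple a = 4 * (s^2 + s * t + t^2)^3 / (27 * (s * t * (s + t))^2)"
proof -
  have "quad a = (s^2 + s * t + t^2) / (s * t)^2" "(vandermonde a)^2 = (s + t)^2 / (s * t)^4"
    using assms by (auto simp: quad_def vandermonde_def field_simps eval_nat_numeral)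
  then have "j_triple a = (4 * (s^2 + s * t + t^2)^3 / (s * t)^6) / (27 * (s + t)^2 / (s * t)^4)"
    by (simp add: j_triple_def power_divide flip: power_mult)
  also have "\<dots> = 4 * (s^2 + s * t + t^2)^3 * (s * t)^4 / (27 * (s + t)^2 * (s * t)^6)"
    by (simp add: mult_ac)
  also have "27 * (s + t)^2 * (s * t)^6 = 27 * (s * t * (s + t))^2 * (s * t)^4"
    by (simp add: power_mult_distrib eval_nat_numeral)
  finally show ?thesis using assms(1,2) by simp
qed

text \<open>In terms of the resolvents this is p(a) q(b) + q(a) p(b). Shifting b by c multiplies the
  two terms by \<omega>^c and \<omega>^-c; reflecting b exchanges p(b) and q(b) up to such
  factors.\<close>

definition pairing :: "(3 \<Rightarrow> 'a::field) \<Rightarrow> (3 \<Rightarrow> 'a) \<Rightarrow> 'a"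
  where "pairing a b = 3 * (a 1 * b 1 + a 2 * b 2 + a 3 * b 3) - (a 1 + a 2 + a 3) * (b 1 + b 2 + b 3)"

definition even_prod :: "(3 \<Rightarrow> 'a::field) \<Rightarrow> (3 \<Rightarrow> 'a) \<Rightarrow> 'a"
  where "even_prod a b = (\<Prod>c\<in>UNIV. pairing a (\<lambda>i. b (i + c)))"

definition odd_prod :: "(3 \<Rightarrow> 'a::field) \<Rightarrow> (3 \<Rightarrow> 'a) \<Rightarrow> 'a"
  where "odd_prod a b = (\<Prod>c\<in>UNIV. pairing a (\<lambda>i. b (c - i)))"

section \<open>Polynomial identities between the pairings\<close>

lemma prod_3: "prod f (UNIV::3 set) = f 1 * f 2 * f 3"
  unfolding UNIV_3 by (simp add: mult_ac)

text \<open>Summed over a family, b becomes a constant triple, and \<open>pairing\<close> vanishes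
  on constants.\<close>

lemma pairing_sum:
  "pairing a (\<lambda>i. b (i + 1)) + pairing a (\<lambda>i. b (i + 2)) + pairing a (\<lambda>i. b (i + 3)) = 0"
  "pairing a (\<lambda>i. b (1 - i)) + pairing a (\<lambda>i. b (2 - i)) + pairing a (\<lambda>i. b (3 - i)) = 0"
  unfolding pairing_def index_3 by (simp_all add: algebra_simps)

text \<open>The pairings of a family have the form X \<omega>^c + Y \<omega>^-c with X Y =
  \<open>quad a * quad b\<close>. As they add up to zero, twice the left side is the sum of their
  squares, which is 6 X Y.\<close>

lemma pairing_quad:
  fixes a b :: "3 \<Rightarrow> 'a::field"
  shows "(pairing a (\<lambda>i. b (i + 2)))^2 + pairing a (\<lambda>i. b (i + 2)) * pairing a (\<lambda>i. b (i + 3))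
      + (pairing a (\<lambda>i. b (i + 3)))^2 = 3 * quad a * quad b"
    and "(pairing a (\<lambda>i. b (2 - i)))^2 + pairing a (\<lambda>i. b (2 - i)) * pairing a (\<lambda>i. b (3 - i))
      + (pairing a (\<lambda>i. b (3 - i)))^2 = 3 * quad a * quad b"
  unfolding pairing_def index_3 quad_def by algebra+

text \<open>The even product is (p(a) q(b))^3 + (q(a) p(b))^3, the odd one (p(a) p(b))^3 + (q(a)
  q(b))^3. Their difference is minus the product of p^3 - q^3 at a and at b, and p^3 - q^3 is a
  square root of -27 times \<open>vandermonde\<close>.\<close>

lemma even_minus_odd: "even_prod a b - odd_prod a b = 27 * vandermonde a * vandermonde b"
  unfolding even_prod_def odd_prod_def prod_3 pairing_def index_3 vandermonde_def
  by algebra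

text \<open>The factored form of p(a)^3 + q(a)^3.\<close>

definition cubic :: "(3 \<Rightarrow> 'a::field) \<Rightarrow> 'a"
  where "cubic a = (2 * a 1 - a 2 - a 3) * (2 * a 2 - a 1 - a 3) * (2 * a 3 - a 1 - a 2)"

lemma even_plus_odd: "even_prod a b + odd_prod a b = cubic a * cubic b"
  unfolding even_prod_def odd_prod_def prod_3 pairing_def index_3 cubic_def
  by algebra

text \<open>This is 4 (p q)^3 = (p^3 + q^3)^2 - (p^3 - q^3)^2.\<close>

lemma cubic_syzygy: "4 * quad a ^ 3 = (cubic a)^2 + 27 * (vandermonde a)^2"
  unfolding quad_def cubic_def vandermonde_def
  by algebra

text \<open>From 4 M N = (M + N)^2 - (M - N)^2; the syzygy removes \<open>cubic\<close>, leaving the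
  invariants that occur in \<open>j_triple\<close>.\<close>

lemma even_times_odd:
  "4 * (even_prod a b * odd_prod a b) =
    16 * (quad a * quad b)^3 - 108 * (quad a ^ 3 * (vandermonde b)^2 + quad b ^ 3 * (vandermonde a)^2)"
proof -
  have "4 * (even_prod a b * odd_prod a b) =
      (even_prod a b + odd_prod a b)^2 - (even_prod a b - odd_prod a b)^2"
    by (simp add: power2_eq_square algebra_simps)
  also have "\<dots> = (4 * quad a ^ 3 - 27 * (vandermonde a)^2) * (4 * quad b ^ 3 - 27 * (vandermonde b)^2)
      - 729 * (vandermonde a)^2 * (vandermonde b)^2"
    unfolding even_plus_odd even_minus_odd cubic_syzygy by (simp add: power_mult_distrib)
  also have "\<dots> = 16 * (quad a * quad b)^3 -
      108 * (quad a ^ 3 * (vandermonde b)^2 + quad b ^ 3 * (vandermonde a)^2)"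
    by (simp add: power_mult_distrib algebra_simps)
  finally show ?thesis .
qed

text \<open>Up to the factor \<open>(det3 u v w)^2\<close>, the left side is the determinant of one
  even and two odd line vectors. The Vandermonde factors do not depend on c, so only the pairings
  survive in cross-ratios.\<close>

lemma even_det:
  fixes a b :: "3 \<Rightarrow> 'a::field"
  shows "line1 a (\<lambda>i. b (i + c)) *
      (line2 a (\<lambda>i. b (1 - i)) * line3 a (\<lambda>i. b (2 - i)) - line3 a (\<lambda>i. b (1 - i)) * line2 a (\<lambda>i. b (2 - i))) +
    line2 a (\<lambda>i. b (i + c)) *
      (line3 a (\<lambda>i. b (1 - i)) * line1 a (\<lambda>i. b (2 - i)) - line1 a (\<lambda>i. b (1 - i)) * line3 a (\<lambda>i. b (2 - i))) +
    line3 a (\<lambda>i. b (i + c)) *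
      (line1 a (\<lambda>i. b (1 - i)) * line2 a (\<lambda>i. b (2 - i)) - line2 a (\<lambda>i. b (1 - i)) * line1 a (\<lambda>i. b (2 - i))) =
    - vandermonde a * (vandermonde b * pairing a (\<lambda>i. b (i + c)))" (is "?P c")
proof -
  have "\<forall>c. ?P c"
    unfolding forall_3 line1_def line2_def line3_def vandermonde_def pairing_def index_3
    by (intro conjI) algebra+
  then show ?thesis by blast
qed

lemma odd_det:
  fixes a b :: "3 \<Rightarrow> 'a::field"
  shows "line1 a (\<lambda>i. b (c - i)) *
      (line2 a (\<lambda>i. b (i + 1)) * line3 a (\<lambda>i. b (i + 2)) - line3 a (\<lambda>i. b (i + 1)) * line2 a (\<lambda>i. b (i + 2))) +
    line2 a (\<lambda>i. b (c - i)) *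
      (line3 a (\<lambda>i. b (i + 1)) * line1 a (\<lambda>i. b (i + 2)) - line1 a (\<lambda>i. b (i + 1)) * line3 a (\<lambda>i. b (i + 2))) +
    line3 a (\<lambda>i. b (c - i)) *
      (line1 a (\<lambda>i. b (i + 1)) * line2 a (\<lambda>i. b (i + 2)) - line2 a (\<lambda>i. b (i + 1)) * line1 a (\<lambda>i. b (i + 2))) =
    - vandermonde a * (vandermonde b * pairing a (\<lambda>i. b (c - i)))" (is "?P c")
proof -
  have "\<forall>c. ?P c"
    unfolding forall_3 line1_def line2_def line3_def vandermonde_def pairing_def index_3
    by (intro conjI) algebra+
  then show ?thesis by blast
qed

section \<open>The signature of the dual structure\<close>

context pappus_frame
begin

abbreviation even_vec :: "3 \<Rightarrow> 'a^3"
  where "even_vec c \<equiv> pappus_vec (\<lambda>i. i + c)"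

abbreviation odd_vec :: "3 \<Rightarrow> 'a^3"
  where "odd_vec c \<equiv> pappus_vec (\<lambda>i. c - i)"

lemma line_vec_add: "line_vec x y z + line_vec x' y' z' = line_vec (x + x') (y + y') (z + z')"
  by (simp add: line_vec_def vec_eq_iff algebra_simps)

text \<open>Summed over a family, values of b become a constant, as do products of two values at
  distinct indices; the remaining differences of a's or b's telescope. This relation is the
  concurrency in Steiner's theorem.\<close>

lemma sum_vecs: "even_vec 1 + even_vec 2 + even_vec 3 = 0" "odd_vec 1 + odd_vec 2 + odd_vec 3 = 0"
proof -
  have 0: "line_vec x y z = 0" if "x = 0" "y = 0" "z = 0" for x y z
    using that by (simp add: line_vec_def)
  show "even_vec 1 + even_vec 2 + even_vec 3 = 0" "odd_vec 1 + odd_vec 2 + odd_vec 3 = 0"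
    unfolding pappus_vec_def line_vec_add line1_def line2_def line3_def comp_def index_3
    by (rule 0; simp add: algebra_simps)+
qed

lemma det3_even_vec: "det3 (even_vec c) (odd_vec 1) (odd_vec 2) =
    - ((det3 u v w)^2 * vandermonde a * vandermonde b) * pairing a (\<lambda>i. b (i + c))"
  unfolding pappus_vec_def det3_line even_det comp_def by simp

lemma det3_odd_vec: "det3 (odd_vec c) (even_vec 1) (even_vec 2) =
    - ((det3 u v w)^2 * vandermonde a * vandermonde b) * pairing a (\<lambda>i. b (c - i))"
  unfolding pappus_vec_def det3_line odd_det comp_def by simp

lemma vandermonde_neq_0: "vandermonde a \<noteq> 0"
  using a_eq_iff by (simp add: vandermonde_def)

text \<open>\<open>dual_frame\<close> applies with l and k proportional to the pairings. The common
  scalar drops out since numerator and denominator in \<open>j_triple_inverse\<close> both have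
  degree 6 in s and t.\<close>

lemma steiner_signature:
  assumes "even_prod a b \<noteq> 0" "odd_prod a b \<noteq> 0" "(27::'a) \<noteq> 0"
  defines "E \<equiv> (quad a * quad b)^3"
  shows "signature (steiner {range A, range B}) =
    (4 * E / (even_prod a b)^2 + 4 * E / (odd_prod a b)^2,
     4 * E / (even_prod a b)^2 * (4 * E / (odd_prod a b)^2))"
proof -
  interpret B: pappus_frame v u w b a B A by (rule swap)
  define \<kappa> where "\<kappa> = - ((det3 u v w)^2 * vandermonde a * vandermonde b)"
  have \<kappa>: "\<kappa> \<noteq> 0"
    using basis vandermonde_neq_0 B.vandermonde_neq_0 by (simp add: \<kappa>_def)
  define m where "m c = pairing a (\<lambda>i. b (i + c))" for c
  define n where "n c = pairing a (\<lambda>i. b (c - i))" for c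
  have l: "det3 (even_vec c) (odd_vec 1) (odd_vec 2) = \<kappa> * m c" for c
    by (simp add: det3_even_vec \<kappa>_def m_def)
  have k: "det3 (odd_vec c) (even_vec 1) (even_vec 2) = \<kappa> * n c" for c
    by (simp add: det3_odd_vec \<kappa>_def n_def)
  have mn: "m c \<noteq> 0" "n c \<noteq> 0" for c
    using assms by (auto simp: even_prod_def odd_prod_def m_def n_def)
  have prods: "even_prod a b = m 1 * m 2 * m 3" "odd_prod a b = n 1 * n 2 * n 3"
    by (simp_all add: even_prod_def odd_prod_def prod_3 m_def n_def)
  have nz: "even_vec c \<noteq> 0" "odd_vec c \<noteq> 0" for c
    using l[of c] k[of c] mn \<kappa> by (auto simp: det3_def)
  let ?a = "\<lambda>i::3. if i = 1 then 0 else if i = 2 then - inverse (\<kappa> * m 2) else inverse (\<kappa> * m 3)"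
  let ?b = "\<lambda>i::3. if i = 1 then 0 else if i = 2 then inverse (\<kappa> * n 2) else - inverse (\<kappa> * n 3)"
  interpret dual: pappus_frame "even_vec 1" "odd_vec 1"
    "cross (cross (odd_vec 1) (odd_vec 2)) (cross (even_vec 1) (even_vec 2))" ?a ?b
    "\<lambda>c. proj_pt (even_vec c)" "\<lambda>c. proj_pt (odd_vec c)"
    using dual_frame[of even_vec odd_vec, OF sum_vecs, unfolded l k] mn \<kappa> by simp
  \<comment> \<open>As r, s, t add up to zero, s + t = - r turns the denominator into the squared
    product of all three. The factor 27 cancels against the cube of the 3 in
    \<open>pairing_quad\<close>.\<close>
  have j: "4 * ((\<kappa> * s)^2 + \<kappa> * s * (\<kappa> * t) + (\<kappa> * t)^2)^3 / (27 * (\<kappa> * s * (\<kappa> * t) * (\<kappa> * s + \<kappa> * t))^2)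
      = 4 * E / (r * s * t)^2"
    if "r + s + t = 0" "s^2 + s * t + t^2 = 3 * quad a * quad b" for r s t
  proof -
    have "(\<kappa> * s)^2 + \<kappa> * s * (\<kappa> * t) + (\<kappa> * t)^2 = \<kappa>^2 * (3 * quad a * quad b)"
      unfolding that(2)[symmetric] by (simp add: power2_eq_square algebra_simps)
    moreover have "r = - (s + t)" using that(1) by (simp only: eq_neg_iff_add_eq_0 add.assoc)
    then have "\<kappa> * s * (\<kappa> * t) * (\<kappa> * s + \<kappa> * t) = - (\<kappa>^3 * (r * s * t))"
      by algebra
    ultimately have "4 * ((\<kappa> * s)^2 + \<kappa> * s * (\<kappa> * t) + (\<kappa> * t)^2)^3 /
        (27 * (\<kappa> * s * (\<kappa> * t) * (\<kappa> * s + \<kappa> * t))^2) =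
        (27 * \<kappa>^6) * (4 * E) / ((27 * \<kappa>^6) * (r * s * t)^2)"
      by (simp add: E_def power_mult_distrib mult_ac flip: power_mult)
    also have "\<dots> = 4 * E / (r * s * t)^2"
      using \<kappa> assms(3) by (intro mult_divide_mult_cancel_left) simp
    finally show ?thesis .
  qed
  have ja: "j_triple ?a = 4 * E / (even_prod a b)^2"
    unfolding prods
    by (subst j_triple_inverse[OF _ _ disjI1[OF refl]], (use \<kappa> mn in simp)+, rule j)
      (simp_all add: m_def pairing_sum pairing_quad)
  have jb: "j_triple ?b = 4 * E / (odd_prod a b)^2"
    unfolding prods
    by (subst j_triple_inverse[OF _ _ disjI2[OF refl]], (use \<kappa> mn in simp)+, rule j)
      (simp_all add: n_def pairing_sum pairing_quad)
  have "steiner {range A, range B} = {range (\<lambda>c. proj_pt (even_vec c)), range (\<lambda>c. proj_pt (odd_vec c))}"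
    by (simp add: steiner_eq pappus_lines_def pappus_line_vec nz)
  then show ?thesis using dual.signature_eq by (simp only: ja jb)
qed

end

text \<open>M and N stand for the even and odd products, E for the cube of
  \<open>quad a * quad b\<close>. The condition x \<noteq> y makes M N nonzero, and y - x + 2 = 2
  (M^2 + N^2) / (M - N)^2 yields the sum of the two fractions.\<close>

lemma steiner_scalars:
  fixes E M N x y :: "'a::field"
  assumes "M \<noteq> N" "y = 16 * E / (M - N)^2" "x - y = - (4 * (M * N)) / (M - N)^2" "x \<noteq> y"
  shows "M \<noteq> 0" "N \<noteq> 0"
    and "4 * E / M^2 + 4 * E / N^2 = 2 * y * (y - x + 2) / (x - y)^2"
    and "4 * E / M^2 * (4 * E / N^2) = y^2 / (x - y)^2"
proof -
  define d where "d = (M - N)^2"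
  have d: "d \<noteq> 0" using assms(1) by (simp add: d_def)
  have nz: "4 * (M * N) \<noteq> 0" using assms(3,4) by auto
  then show MN: "M \<noteq> 0" "N \<noteq> 0" by auto
  have four: "(4::'a) \<noteq> 0" using nz by auto
  have y: "y = 16 * E / d" and xy: "x - y = - (4 * (M * N)) / d"
    using assms by (simp_all add: d_def)
  have sq: "(x - y)^2 = (4 * (M * N))^2 / d^2"
    unfolding xy by (simp add: power_divide)
  have "y - x + 2 = (4 * (M * N) + 2 * d) / d"
    using xy d by (simp add: field_simps)
  also have "4 * (M * N) + 2 * d = 2 * (M^2 + N^2)"
    by (simp add: d_def power2_eq_square algebra_simps)
  finally have num: "y - x + 2 = 2 * (M^2 + N^2) / d" .
  have frac: "(2 * (16 * E / d) * (2 * q / d)) / (r / d^2) = 64 * E * q / r" for q r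
    using d by (simp add: power2_eq_square)
  have "2 * y * (y - x + 2) / (x - y)^2 =
      (2 * (16 * E / d) * (2 * (M^2 + N^2) / d)) / ((4 * (M * N))^2 / d^2)"
    unfolding sq num unfolding y ..
  also have "\<dots> = (4^2 * (4 * E * (M^2 + N^2))) / (4^2 * (M * N)^2)"
    unfolding frac power_mult_distrib[of 4] by simp
  also have "\<dots> = 4 * E * (M^2 + N^2) / (M * N)^2"
    using four by (intro mult_divide_mult_cancel_left power_not_zero)
  also have "\<dots> = 4 * E / M^2 + 4 * E / N^2"
    using MN by (simp add: field_simps power2_eq_square)
  finally show "4 * E / M^2 + 4 * E / N^2 = 2 * y * (y - x + 2) / (x - y)^2" by simp
  have "y^2 / (x - y)^2 = (4^2 * (4 * E)^2) / (4^2 * (M * N)^2)"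
    unfolding sq unfolding y using d by (simp add: power_divide power_mult_distrib)
  also have "\<dots> = (4 * E)^2 / (M * N)^2"
    using four by (intro mult_divide_mult_cancel_left power_not_zero)
  finally show "4 * E / M^2 * (4 * E / N^2) = y^2 / (x - y)^2"
    by (simp add: power2_eq_square mult_ac)
qed

text \<open>Over the common denominator (27 V(a) V(b))^2, which is (M - N)^2 by
  \<open>even_minus_odd\<close>, the numerator is the one computed in \<open>even_times_odd\<close>,
  negated.\<close>

lemma j_triple_difference:
  fixes a b :: "3 \<Rightarrow> 'a::field"
  assumes "(27::'a) \<noteq> 0" "vandermonde a \<noteq> 0" "vandermonde b \<noteq> 0"
  shows "j_triple a * j_triple b = 16 * (quad a * quad b)^3 / (even_prod a b - odd_prod a b)^2"
    and "j_triple a + j_triple b - j_triple a * j_triple b =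
      - (4 * (even_prod a b * odd_prod a b)) / (even_prod a b - odd_prod a b)^2"
proof -
  show prod: "j_triple a * j_triple b = 16 * (quad a * quad b)^3 / (even_prod a b - odd_prod a b)^2"
    unfolding even_minus_odd j_triple_def by (simp add: power_mult_distrib mult_ac)
  have "j_triple a = 108 * (quad a ^ 3 * (vandermonde b)^2) / (27 * vandermonde a * vandermonde b)^2"
    and "j_triple b = 108 * (quad b ^ 3 * (vandermonde a)^2) / (27 * vandermonde a * vandermonde b)^2"
  proof -
    have e: "4 * q / (27 * r) = 108 * (q * t) / (729 * (r * t))"
      if "t \<noteq> 0" for q r t :: 'a
    proof -
      have "108 * (q * t) / (729 * (r * t)) = ((27 * t) * (4 * q)) / ((27 * t) * (27 * r))"
        by (simp add: mult_ac)
      also have "\<dots> = 4 * q / (27 * r)"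
        using that assms(1) by (intro mult_divide_mult_cancel_left) simp
      finally show ?thesis by simp
    qed
    show "j_triple a = 108 * (quad a ^ 3 * (vandermonde b)^2) / (27 * vandermonde a * vandermonde b)^2"
      "j_triple b = 108 * (quad b ^ 3 * (vandermonde a)^2) / (27 * vandermonde a * vandermonde b)^2"
      unfolding j_triple_def
      using e[of "(vandermonde b)^2" "quad a ^ 3" "(vandermonde a)^2"]
        e[of "(vandermonde a)^2" "quad b ^ 3" "(vandermonde b)^2"] assms
      by (simp_all add: power_mult_distrib mult_ac)
  qed
  then show "j_triple a + j_triple b - j_triple a * j_triple b =
      - (4 * (even_prod a b * odd_prod a b)) / (even_prod a b - odd_prod a b)^2"
    unfolding prod even_times_odd even_minus_odd
    by (simp only: add_divide_distrib[symmetric] diff_divide_distrib[symmetric]) (simp add: algebra_simps)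
qed

theorem theorem2p4:
  fixes \<P> :: "'a::field proj_plane set set" and x y :: 'a
  assumes "CHAR('a) \<noteq> 2" and "CHAR('a) \<noteq> 3"
    and "pappus_structure \<P>"
    and "signature \<P> = (x, y)"
    and "x \<noteq> y"
  shows "signature (steiner \<P>) =
    (2 * y * (y - x + 2) / (x - y)^2, y^2 / (x - y)^2)"
proof -
  obtain A B where lab: "pappus_labelling \<P> A B"
    using assms(3) by (auto simp: pappus_structure_def)
  then obtain u v w a b where "pappus_frame u v w a b A B"
    by (rule pappus_frame_exists)
  then interpret pappus_frame u v w a b A B .
  interpret B: pappus_frame v u w b a B A by (rule swap)
  have P: "\<P> = {range A, range B}" using lab by (simp add: pappus_labelling_def)
  \<comment> \<open>A positive divisor of 3 is at most 3; 2 and 3 are excluded by hypothesis, and a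
    field never has characteristic 1.\<close>
  have "\<not> CHAR('a) dvd 3"
  proof
    assume d: "CHAR('a) dvd 3"
    then have "CHAR('a) \<le> 3" by (simp add: dvd_imp_le)
    moreover have "CHAR('a) \<noteq> 0" using d by (metis dvd_0_left zero_neq_numeral)
    moreover have "CHAR('a) \<noteq> Suc 0" by (rule CHAR_not_1')
    ultimately show False using assms(1,2) by linarith
  qed
  then have "(3::'a) \<noteq> 0"
    using of_nat_eq_0_iff_char_dvd[of 3, where ?'a = 'a] by simp
  then have "(3::'a)^3 \<noteq> 0" by (rule power_not_zero)
  then have 27: "(27::'a) \<noteq> 0" by simp
  have x: "x = j_triple a + j_triple b" and y: "y = j_triple a * j_triple b"
    using assms(4) signature_eq by (simp_all add: P)
  have "even_prod a b \<noteq> odd_prod a b"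
    using even_minus_odd[of a b] 27 vandermonde_neq_0 B.vandermonde_neq_0 by auto
  \<comment> \<open>Here x \<noteq> y enters: both products are nonzero, which makes the dual
    structure non-degenerate.\<close>
  note scalars = steiner_scalars[OF this
      j_triple_difference[OF 27 vandermonde_neq_0 B.vandermonde_neq_0, folded x y] assms(5)]
  show ?thesis
    unfolding P steiner_signature[OF scalars(1,2) 27] scalars(3,4) ..
qed

end
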